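(* Let $\mathcal G_1=(G_1,\dots,G_d)$ and $\mathcal G_2=(G'_1,\dots,G'_{d'})$ be two snake graphs. Then there are bijections (1) for every overlap $\mathcal G$ of $\mathcal G_1$ and $\mathcal G_2$, $$\varphi=(\varphi_{34},\varphi_{56}):\ \mathrm{Match}(\mathcal G_1\sqcup\mathcal G_2)\longrightarrow \mathrm{Match}(\mathrm{Res}_{\mathcal G}(\mathcal G_1,\mathcal G_2));$$ (2) for every $s$ and $\delta_3$ for which the resolution of the grafting of $\mathcal G_2$ on $\mathcal G_1$ is defined, $$\varphi=(\varphi_{34},\varphi_{56}):\ \mathrm{Match}(\mathcal G_1\sqcup\mathcal G_2)\longrightarrow \mathrm{Match}(\mathrm{Graft}_{s,\delta_3}(\mathcal G_1,\mathcal G_2)).$$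
   Context: **Snake graphs.** A tile is a square of fixed side length in the plane with sides parallel to the axes, viewed as a graph with 4 vertices and 4 edges (north, south, east, west). A snake graph $\mathcal G=(G_1,\dots,G_d)$, $d\ge1$, is a connected graph consisting of a finite sequence of tiles such that for each $i=1,\dots,d-1$: $G_i$ and $G_{i+1}$ share exactly one edge $e_i$, which is either the north edge of $G_i$ and the south edge of $G_{i+1}$, or the east edge of $G_i$ and the west edge of $G_{i+1}$; $G_i,G_j$ have no common edge if $|i-j|\ge2$; $G_i,G_j$ are disjoint if $|i-j|\ge3$. The edges $e_1,\dots,e_{d-1}$ are the interior edges, all other edges are boundary edges. A graph with a single edge and two endpoints is called an empty snake graph. $\mathcal G[i,j]$ is the subgraph $(G_i,\dots,G_j)$, empty (no edges) if $i>j$. $\overline{\mathcal G}[j,i]$ is the snake graph obtained by reflecting $\mathcal G[i,j]$ in a line of slope $-1$, so that the order of the tiles is reversed. A snake graph is straight if all its tiles lie in one row or one column, and zigzag if no three consecutive tiles are straight. **Sign function.** A sign function $f$ on a snake graph is a map from its edges to $\{+,-\}$ such that on every tile the north and west edges have the same sign, the south and east edges have the same sign, and north and south have opposite signs. A nonempty snake graph has exactly two sign functions. **Overlap.** An embedding of a snake graph into another sends its tiles, in order, to consecutive tiles, and is induced by a translation, possibly composed with a reflection in a line of slope $1$ (both preserve snake graphs and sign functions). $\mathcal G_1$ and $\mathcal G_2$ have an overlap $\mathcal G$ if $\mathcal G$ is a snake graph with embeddings $i_1:\mathcal G\to\mathcal G_1$, $i_2:\mathcal G\to\mathcal G_2$,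 with $i_1(\mathcal G)=\mathcal G_1[s,t]$, $i_2(\mathcal G)=\mathcal G_2[s',t']$, that are maximal in this sense: (i) if $\mathcal G$ has at least two tiles: whenever a snake graph $\mathcal G'$ has embeddings $i'_1:\mathcal G'\to\mathcal G_1$, $i'_2:\mathcal G'\to\mathcal G_2$ with $i_1(\mathcal G)\subseteq i_1'(\mathcal G')$ and $i_2(\mathcal G)\subseteq i'_2(\mathcal G')$, equality holds in both; (ii) if $\mathcal G$ is a single tile, with $G_k=i_1(\mathcal G)$, $G'_{k'}=i_2(\mathcal G)$: either $k\in\{1,d\}$ or $k'\in\{1,d'\}$; or $1<k<d$, $1<k'<d'$ and $(G_{k-1},G_k,G_{k+1})$, $(G'_{k'-1},G'_{k'},G'_{k'+1})$ are both straight or both zigzag. Let $e_j$, $e'_j$ be the interior edges of $\mathcal G_1$, $\mathcal G_2$. A sign function $f$ on $\mathcal G$ induces sign functions $f_1$ on $\mathcal G_1$ and $f_2$ on $\mathcal G_2$. By maximality (for a single tile: by the choice of the embeddings), $f_1(e_{s-1})=-f_2(e'_{s'-1})$ if $s>1,s'>1$, and $f_1(e_t)=-f_2(e'_{t'})$ if $t<d,t'<d'$. Replacing $\mathcal G_2$ by its mirror image in a line of slope $1$ if necessary, one takes $i_1,i_2$ to be translations below. **Crossing.** $\mathcal G_1$ and $\mathcal G_2$ cross in $\mathcal G$ if one of the following holds: (i) $f_1(e_{s-1})=-f_1(e_t)$ with $s>1,t<d$; or $f_2(e'_{s'-1})=-f_2(e'_{t'})$ with $s'>1,t'<d'$; (ii)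 $f_1(e_t)=f_2(e'_{s'-1})$ with $s=1,t<d,s'>1,t'=d'$; or $f_1(e_{s-1})=f_2(e'_{t'})$ with $s>1,t=d,s'=1,t'<d'$. **Resolution.** If $\mathcal G_1,\mathcal G_2$ cross in $\mathcal G$, define: $\mathcal G_3=\mathcal G_1[1,t]\cup\mathcal G_2[t'+1,d']$, adjacency of the two pieces induced by $\mathcal G_2$. $\mathcal G_4=\mathcal G_2[1,t']\cup\mathcal G_1[t+1,d]$, adjacency induced by $\mathcal G_1$. $\mathcal G_5$: if $s>1,s'>1$: $\mathcal G_1[1,s-1]\cup\overline{\mathcal G}_2[s'-1,1]$, glued along the north edge of $G_{s-1}$ and the (original) east edge of $G'_{s'-1}$ if $G_s$ is east of $G_{s-1}$, and along the east edge of $G_{s-1}$ and the (original) north edge of $G'_{s'-1}$ if $G_s$ is north of $G_{s-1}$. If $s'=1$: $\mathcal G_1[1,k]$ with $k<s-1$ the largest integer such that $f_1(e_k)=f_1(e_{s-1})$ if it exists; otherwise $\{e_0\}$, with $e_0$ the unique south or west edge of $G_1$ with $f_1(e_0)=f_1(e_{s-1})$. If $s=1$: $\overline{\mathcal G}_2[k',1]$ with $k'<s'-1$ the largest integer such that $f_2(e'_{k'})=f_2(e'_{s'-1})$ if it exists; otherwise $\{e'_0\}$, with $e'_0$ the unique south or west edge of $G'_1$ with $f_2(e'_0)=f_2(e'_{s'-1})$. $\mathcal G_6$: if $t<d,t'<d'$: $\overline{\mathcal G}_2[d',t'+1]\cup\mathcal G_1[t+1,d]$, glued along the west edge of $G_{t+1}$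 and the (original) south edge of $G'_{t'+1}$ if $G_{t+1}$ is north of $G_t$, and along the south edge of $G_{t+1}$ and the (original) west edge of $G'_{t'+1}$ if $G_{t+1}$ is east of $G_t$. If $t=d$: $\overline{\mathcal G}_2[d',k']$ with $k'>t'+1$ the least integer such that $f_2(e'_{t'})=f_2(e'_{k'-1})$ if it exists; otherwise $\{e'_{d'}\}$, with $e'_{d'}$ the unique north or east edge of $G'_{d'}$ with $f_2(e'_{d'})=f_2(e'_{t'})$. If $t'=d'$: $\mathcal G_1[k,d]$ with $k>t+1$ the least integer such that $f_1(e_t)=f_1(e_{k-1})$ if it exists; otherwise $\{e_d\}$, with $e_d$ the unique north or east edge of $G_d$ with $f_1(e_d)=f_1(e_t)$. Then $\mathrm{Res}_{\mathcal G}(\mathcal G_1,\mathcal G_2)=(\mathcal G_3\sqcup\mathcal G_4,\mathcal G_5\sqcup\mathcal G_6)$. If $\mathcal G_1,\mathcal G_2$ do not cross in $\mathcal G$, $\mathrm{Res}_{\mathcal G}(\mathcal G_1,\mathcal G_2)=\mathcal G_1\sqcup\mathcal G_2$. **Grafting** (no overlap required). Let $f_1$ be a sign function on $\mathcal G_1$. Case 1: $1<s<d$. If $G_{s+1}$ is north of $G_s$, let $\delta_3$ be the east edge of $G_s$, $\delta_5$ the west edge of $G_{s+1}$, $\delta'_3$ the west edge of $G'_1$, $\delta'_5$ the south edge of $G'_1$. If $G_{s+1}$ is east of $G_s$, let $\delta_3$ be the north edge of $G_s$, $\delta_5$ the south edge of $G_{s+1}$, $\delta'_3$ the south edge of $G'_1$,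 $\delta'_5$ the west edge of $G'_1$. Put $\mathcal G_3=\mathcal G_1[1,s]\cup\mathcal G_2$ glued along $\delta_3,\delta'_3$; $\mathcal G_4=\mathcal G_1[k_4,d]$ with $k_4>s+1$ the least integer such that $f_1(e_s)=-f_1(e_{k_4-1})$ if it exists, otherwise $\{e_d\}$ with $e_d$ the unique north or east edge of $G_d$ with $f_1(e_s)=-f_1(e_d)$; $\mathcal G_5=\mathcal G_1[1,k_5]$ with $k_5<s$ the largest integer such that $f_1(e_{k_5})=-f_1(e_s)$ if it exists, otherwise $\{e_0\}$ with $e_0$ the unique south or west edge of $G_1$ with $f_1(e_0)=-f_1(e_s)$; $\mathcal G_6=\overline{\mathcal G}_2[d',1]\cup\mathcal G_1[s+1,d]$ glued along $\delta_5,\delta'_5$. Case 2: $s=d$. Choose $(\delta_3,\delta_3')$ to be either (north edge of $G_d$, south edge of $G'_1$) or (east edge of $G_d$, west edge of $G'_1$). Let $f_2$ be the sign function on $\mathcal G_2$ with $f_2(\delta'_3)=f_1(\delta_3)$. Put $\mathcal G_3=\mathcal G_1\cup\mathcal G_2$ glued along $\delta_3,\delta'_3$; $\mathcal G_4=\{\delta_3\}$; $\mathcal G_5=\mathcal G_1[1,k_5]$ with $k_5<d$ the largest integer such that $f_1(e_{k_5})=f_1(\delta_3)$ if it exists, otherwise $\{e_0\}$ with $e_0$ the unique south or west edge of $G_1$ with $f_1(e_0)=f_1(\delta_3)$; $\mathcal G_6=\overline{\mathcal G}_2[d',k_6]$ with $k_6>1$ the least integer such that $f_2(e'_{k_6-1})=f_1(\delta_3)$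 if it exists, otherwise $\{e'_{d'}\}$ with $e'_{d'}$ the unique north or east edge of $G'_{d'}$ with $f_2(e'_{d'})=f_1(\delta_3)$. Then $\mathrm{Graft}_{s,\delta_3}(\mathcal G_1,\mathcal G_2)=(\mathcal G_3\sqcup\mathcal G_4,\mathcal G_5\sqcup\mathcal G_6)$. **Matchings.** $\mathrm{Match}(H)$ is the set of perfect matchings of a graph $H$. For a pair, $\mathrm{Match}(\mathcal G_3\sqcup\mathcal G_4,\mathcal G_5\sqcup\mathcal G_6)$ means the disjoint union $\mathrm{Match}(\mathcal G_3\sqcup\mathcal G_4)\sqcup\mathrm{Match}(\mathcal G_5\sqcup\mathcal G_6)$; $\varphi=(\varphi_{34},\varphi_{56})$ records in which part the image lies. *)

theory Defs
  imports "HOL-Library.Product_Plus"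
begin

subsection \<open>Graphs and perfect matchings\<close>

type_synonym 'v graph = "'v set \<times> 'v set set"

definition verts :: "'v graph \<Rightarrow> 'v set" where
  "verts H = fst H"

definition edges :: "'v graph \<Rightarrow> 'v set set" where
  "edges H = snd H"

definition Match :: "'v graph \<Rightarrow> 'v set set set" where
  "Match H = {M. M \<subseteq> edges H \<and> (\<forall>v\<in>verts H. \<exists>!e. e \<in> M \<and> v \<in> e)}"

definition disjoint_union :: "'v graph \<Rightarrow> 'w graph \<Rightarrow> ('v + 'w) graph" where
  "disjoint_union H K =
     (verts H <+> verts K, (\<lambda>e. Inl ` e) ` edges H \<union> (\<lambda>e. Inr ` e) ` edges K)"

text \<open>
  A resolution is a list of graphs: \<open>[H]\<close> stands for a single graph, \<open>[H, K]\<close> for the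
  pair \<open>(H, K)\<close>. Its set of matchings is the disjoint union of the sets of matchings of
  the entries; the index in \<open>(i, M)\<close> records the entry of which \<open>M\<close> is a matching.
\<close>

definition Match_list :: "'v graph list \<Rightarrow> (nat \<times> 'v set set) set" where
  "Match_list Hs = (SIGMA i:{..<length Hs}. Match (Hs ! i))"


subsection \<open>Tiles and snake graphs\<close>

text \<open>
  A tile has side length 1 and is given by its lower left corner. Snake graphs matter only up
  to translation and consecutive tiles share an edge, so it is no restriction to place the
  corners on the integer lattice. Edges are sets of two lattice points.
\<close>

type_synonym point = "int \<times> int"
type_synonym tile = point
type_synonym edge = "point set"

datatype side = North | East | South | West

fun side_edge :: "side \<Rightarrow> tile \<Rightarrow> edge" where
  "side_edge South (x, y) = {(x, y), (x + 1, y)}"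
| "side_edge North (x, y) = {(x, y + 1), (x + 1, y + 1)}"
| "side_edge West (x, y) = {(x, y), (x, y + 1)}"
| "side_edge East (x, y) = {(x + 1, y), (x + 1, y + 1)}"

definition tile_edges :: "tile \<Rightarrow> edge set" where
  "tile_edges T = {side_edge North T, side_edge East T, side_edge South T, side_edge West T}"

definition tile_verts :: "tile \<Rightarrow> point set" where
  "tile_verts T = \<Union> (tile_edges T)"

text \<open>Tiles, and the interior edges below, are numbered from 1.\<close>

definition nth_tile :: "tile list \<Rightarrow> nat \<Rightarrow> tile" where
  "nth_tile G i = G ! (i - 1)"

definition next_is_north :: "tile list \<Rightarrow> nat \<Rightarrow> bool" where
  "next_is_north G i \<longleftrightarrow>
     side_edge North (nth_tile G i) = side_edge South (nth_tile G (i + 1))"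

definition next_is_east :: "tile list \<Rightarrow> nat \<Rightarrow> bool" where
  "next_is_east G i \<longleftrightarrow>
     side_edge East (nth_tile G i) = side_edge West (nth_tile G (i + 1))"

definition snake_graph :: "tile list \<Rightarrow> bool" where
  "snake_graph G \<longleftrightarrow>
     length G \<ge> 1 \<and>
     (\<forall>i. 1 \<le> i \<and> i < length G \<longrightarrow>
        card (tile_edges (nth_tile G i) \<inter> tile_edges (nth_tile G (i + 1))) = 1 \<and>
        (next_is_north G i \<or> next_is_east G i)) \<and>
     (\<forall>i j. 1 \<le> i \<and> i + 2 \<le> j \<and> j \<le> length G \<longrightarrow>
        tile_edges (nth_tile G i) \<inter> tile_edges (nth_tile G j) = {}) \<and>
     (\<forall>i j. 1 \<le> i \<and> i + 3 \<le> j \<and> j \<le> length G \<longrightarrow>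
        tile_verts (nth_tile G i) \<inter> tile_verts (nth_tile G j) = {})"

definition graph_of :: "tile list \<Rightarrow> point graph" where
  "graph_of G = (\<Union> (tile_verts ` set G), \<Union> (tile_edges ` set G))"

text \<open>The empty snake graph with edge \<open>e\<close>.\<close>

definition single_edge :: "edge \<Rightarrow> point graph" where
  "single_edge e = (e, {e})"

definition interior_edge :: "tile list \<Rightarrow> nat \<Rightarrow> edge" where
  "interior_edge G i =
     (if next_is_north G i then side_edge North (nth_tile G i) else side_edge East (nth_tile G i))"

definition sub_snake :: "tile list \<Rightarrow> nat \<Rightarrow> nat \<Rightarrow> tile list" where
  "sub_snake G i j = drop (i - 1) (take j G)"

definition straight :: "tile list \<Rightarrow> bool" where
  "straight G \<longleftrightarrow> (\<exists>c. \<forall>T\<in>set G. snd T = c) \<or> (\<exists>c. \<forall>T\<in>set G. fst T = c)"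

definition zigzag :: "tile list \<Rightarrow> bool" where
  "zigzag G \<longleftrightarrow> (\<forall>i. 1 \<le> i \<and> i + 2 \<le> length G \<longrightarrow> \<not> straight (sub_snake G i (i + 2)))"

definition translate :: "point \<Rightarrow> tile list \<Rightarrow> tile list" where
  "translate v G = map (\<lambda>T. v + T) G"

text \<open>
  Reflection in the line \<open>y = -x\<close>, with the tiles listed in reverse order. The point
  \<open>(x, y)\<close> goes to \<open>(-y, -x)\<close>; the lower left corner of the image of a tile is the image of
  its upper right corner. A side of a tile becomes the side \<open>rev_side\<close> of its image.
\<close>

definition rev_snake :: "tile list \<Rightarrow> tile list" where
  "rev_snake G = rev (map (\<lambda>(x, y). (- y - 1, - x - 1)) G)"

fun rev_side :: "side \<Rightarrow> side" where
  "rev_side North = West"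
| "rev_side West = North"
| "rev_side East = South"
| "rev_side South = East"

text \<open>
  Gluing along the edge \<open>a\<close> of the last tile of \<open>A\<close> and the edge \<open>b\<close> of the first tile of
  \<open>B\<close>: the second graph is translated so that these edges coincide. Used only if \<open>(a, b)\<close> is
  \<open>(North, South)\<close> or \<open>(East, West)\<close>.
\<close>

fun lower_left_end :: "side \<Rightarrow> tile \<Rightarrow> point" where
  "lower_left_end South (x, y) = (x, y)"
| "lower_left_end West (x, y) = (x, y)"
| "lower_left_end North (x, y) = (x, y + 1)"
| "lower_left_end East (x, y) = (x + 1, y)"

definition glue :: "tile list \<Rightarrow> side \<Rightarrow> tile list \<Rightarrow> side \<Rightarrow> tile list" where
  "glue A a B b = A @ translate (lower_left_end a (last A) - lower_left_end b (hd B)) B"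


subsection \<open>Sign functions\<close>

text \<open>Signs are the integers 1 and -1; values outside the edges of the graph are irrelevant.\<close>

definition sign_function :: "(edge \<Rightarrow> int) \<Rightarrow> tile list \<Rightarrow> bool" where
  "sign_function f G \<longleftrightarrow>
     (\<forall>e\<in>edges (graph_of G). f e \<in> {1, -1}) \<and>
     (\<forall>T\<in>set G. f (side_edge North T) = f (side_edge West T) \<and>
                f (side_edge South T) = f (side_edge East T) \<and>
                f (side_edge North T) = - f (side_edge South T))"


subsection \<open>Overlaps\<close>

text \<open>
  A motion \<open>(r, v)\<close> is translation by \<open>v\<close>, preceded if \<open>r\<close> by reflection in the line
  \<open>y = x\<close>. Both maps preserve lower left corners, so a motion acts on tiles as on points.
\<close>

type_synonym motion = "bool \<times> point"

definition move :: "motion \<Rightarrow> point \<Rightarrow> point" where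
  "move m p = snd m + (if fst m then prod.swap p else p)"

definition embedding :: "motion \<Rightarrow> tile list \<Rightarrow> tile list \<Rightarrow> nat \<Rightarrow> nat \<Rightarrow> bool" where
  "embedding m G H s t \<longleftrightarrow>
     1 \<le> s \<and> s \<le> t \<and> t \<le> length H \<and> map (move m) G = sub_snake H s t"

definition induced_signs ::
  "tile list \<Rightarrow> motion \<Rightarrow> motion \<Rightarrow> tile list \<Rightarrow> tile list \<Rightarrow>
   (edge \<Rightarrow> int) \<Rightarrow> (edge \<Rightarrow> int) \<Rightarrow> (edge \<Rightarrow> int) \<Rightarrow> bool" where
  "induced_signs G i1 i2 G1 G2 f f1 f2 \<longleftrightarrow>
     sign_function f G \<and> sign_function f1 G1 \<and> sign_function f2 G2 \<and>
     (\<forall>e\<in>edges (graph_of G). f1 (move i1 ` e) = f e \<and> f2 (move i2 ` e) = f e)"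

text \<open>
  For a single tile the embeddings are required to be chosen so that the signs at the two ends
  of the overlap are opposite; for at least two tiles this follows from maximality.
\<close>

definition overlap ::
  "tile list \<Rightarrow> motion \<Rightarrow> motion \<Rightarrow> nat \<Rightarrow> nat \<Rightarrow> nat \<Rightarrow> nat \<Rightarrow> tile list \<Rightarrow> tile list \<Rightarrow> bool" where
  "overlap G i1 i2 s t s' t' G1 G2 \<longleftrightarrow>
     snake_graph G \<and> embedding i1 G G1 s t \<and> embedding i2 G G2 s' t' \<and>
     (length G \<ge> 2 \<longrightarrow>
        (\<forall>H j1 j2 a b a' b'.
           snake_graph H \<and> embedding j1 H G1 a b \<and> embedding j2 H G2 a' b' \<and>
           move i1 ` set G \<subseteq> move j1 ` set H \<and> move i2 ` set G \<subseteq> move j2 ` set H \<longrightarrow>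
           move i1 ` set G = move j1 ` set H \<and> move i2 ` set G = move j2 ` set H)) \<and>
     (length G = 1 \<longrightarrow>
        (s \<in> {1, length G1} \<or> s' \<in> {1, length G2} \<or>
         (let N = sub_snake G1 (s - 1) (s + 1); N' = sub_snake G2 (s' - 1) (s' + 1)
          in (straight N \<and> straight N') \<or> (zigzag N \<and> zigzag N'))) \<and>
        (\<forall>f f1 f2. induced_signs G i1 i2 G1 G2 f f1 f2 \<longrightarrow>
           (s > 1 \<and> s' > 1 \<longrightarrow>
              f1 (interior_edge G1 (s - 1)) = - f2 (interior_edge G2 (s' - 1))) \<and>
           (t < length G1 \<and> t' < length G2 \<longrightarrow>
              f1 (interior_edge G1 t) = - f2 (interior_edge G2 t'))))"

definition crosses ::
  "tile list \<Rightarrow> tile list \<Rightarrow> nat \<Rightarrow> nat \<Rightarrow> nat \<Rightarrow> nat \<Rightarrow>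
   (edge \<Rightarrow> int) \<Rightarrow> (edge \<Rightarrow> int) \<Rightarrow> bool" where
  "crosses G1 G2 s t s' t' f1 f2 \<longleftrightarrow>
     (let d = length G1; d' = length G2; e = interior_edge G1; e' = interior_edge G2
      in (s > 1 \<and> t < d \<and> f1 (e (s - 1)) = - f1 (e t)) \<or>
         (s' > 1 \<and> t' < d' \<and> f2 (e' (s' - 1)) = - f2 (e' t')) \<or>
         (s = 1 \<and> t < d \<and> s' > 1 \<and> t' = d' \<and> f1 (e t) = f2 (e' (s' - 1))) \<or>
         (s > 1 \<and> t = d \<and> s' = 1 \<and> t' < d' \<and> f1 (e (s - 1)) = f2 (e' t')))"


subsection \<open>Resolutions\<close>

text \<open>
  \<open>initial_piece R G f m c\<close> is \<open>R (G[1,k])\<close> with \<open>k < m\<close> maximal such that the interior edge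
  \<open>e_k\<close> has sign \<open>c\<close>, and a single south or west edge of the first tile if there is no such
  \<open>k\<close>; \<open>final_piece R G f m c\<close> is \<open>R (G[k,d])\<close> with \<open>k > m\<close> minimal such that \<open>e_(k-1)\<close> has
  sign \<open>c\<close>, with a north or east edge of the last tile as fallback. Here \<open>R\<close> is the identity
  or \<open>rev_snake\<close>.
\<close>

definition initial_piece ::
  "(tile list \<Rightarrow> tile list) \<Rightarrow> tile list \<Rightarrow> (edge \<Rightarrow> int) \<Rightarrow> nat \<Rightarrow> int \<Rightarrow> point graph" where
  "initial_piece R G f m c =
     (let K = {k. 1 \<le> k \<and> k < m \<and> f (interior_edge G k) = c}; T = nth_tile G 1
      in if K \<noteq> {} then graph_of (R (sub_snake G 1 (Max K)))
         else single_edge (THE e. e \<in> {side_edge South T, side_edge West T} \<and> f e = c))"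

definition final_piece ::
  "(tile list \<Rightarrow> tile list) \<Rightarrow> tile list \<Rightarrow> (edge \<Rightarrow> int) \<Rightarrow> nat \<Rightarrow> int \<Rightarrow> point graph" where
  "final_piece R G f m c =
     (let d = length G; K = {k. m < k \<and> k \<le> d \<and> f (interior_edge G (k - 1)) = c};
          T = nth_tile G d
      in if K \<noteq> {} then graph_of (R (sub_snake G (Min K) d))
         else single_edge (THE e. e \<in> {side_edge North T, side_edge East T} \<and> f e = c))"

text \<open>
  In the following definitions the overlap is \<open>G1[s,t]\<close>, \<open>G2[s',t']\<close>, and these differ by a
  translation. In \<open>res3\<close> and \<open>res4\<close> the second piece is placed by superimposing the tiles
  \<open>G_t\<close> and \<open>G'_(t')\<close>.
\<close>

definition res3 :: "tile list \<Rightarrow> tile list \<Rightarrow> nat \<Rightarrow> nat \<Rightarrow> point graph" where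
  "res3 G1 G2 t t' = graph_of
     (sub_snake G1 1 t @
      translate (nth_tile G1 t - nth_tile G2 t') (sub_snake G2 (t' + 1) (length G2)))"

definition res4 :: "tile list \<Rightarrow> tile list \<Rightarrow> nat \<Rightarrow> nat \<Rightarrow> point graph" where
  "res4 G1 G2 t t' = graph_of
     (sub_snake G2 1 t' @
      translate (nth_tile G2 t' - nth_tile G1 t) (sub_snake G1 (t + 1) (length G1)))"

text \<open>The case \<open>s = s' = 1\<close> does not occur for a crossing overlap.\<close>

definition res5 ::
  "tile list \<Rightarrow> tile list \<Rightarrow> nat \<Rightarrow> nat \<Rightarrow> (edge \<Rightarrow> int) \<Rightarrow> (edge \<Rightarrow> int) \<Rightarrow> point graph" where
  "res5 G1 G2 s s' f1 f2 =
     (if s > 1 \<and> s' > 1 then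
        (let A = sub_snake G1 1 (s - 1); B = rev_snake (sub_snake G2 1 (s' - 1))
         in graph_of (if next_is_east G1 (s - 1) then glue A North B (rev_side East)
                      else glue A East B (rev_side North)))
      else if s' = 1 then
        initial_piece (\<lambda>A. A) G1 f1 (s - 1) (f1 (interior_edge G1 (s - 1)))
      else
        initial_piece rev_snake G2 f2 (s' - 1) (f2 (interior_edge G2 (s' - 1))))"

text \<open>The case \<open>t = d\<close>, \<open>t' = d'\<close> does not occur for a crossing overlap.\<close>

definition res6 ::
  "tile list \<Rightarrow> tile list \<Rightarrow> nat \<Rightarrow> nat \<Rightarrow> (edge \<Rightarrow> int) \<Rightarrow> (edge \<Rightarrow> int) \<Rightarrow> point graph" where
  "res6 G1 G2 t t' f1 f2 =
     (let d = length G1; d' = length G2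
      in if t < d \<and> t' < d' then
           (let A = rev_snake (sub_snake G2 (t' + 1) d'); B = sub_snake G1 (t + 1) d
            in graph_of (if next_is_north G1 t then glue A (rev_side South) B West
                         else glue A (rev_side West) B South))
         else if t = d then
           final_piece rev_snake G2 f2 (t' + 1) (f2 (interior_edge G2 t'))
         else
           final_piece (\<lambda>A. A) G1 f1 (t + 1) (f1 (interior_edge G1 t)))"

text \<open>
  If one of the embeddings involves a reflection and the other does not, \<open>G2\<close> is first
  replaced by its mirror image \<open>H2\<close>, and the sign function \<open>f2\<close> is transported to \<open>H2\<close>.
\<close>

definition Res ::
  "tile list \<Rightarrow> tile list \<Rightarrow> motion \<Rightarrow> motion \<Rightarrow> nat \<Rightarrow> nat \<Rightarrow> nat \<Rightarrow> nat \<Rightarrow>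
   (edge \<Rightarrow> int) \<Rightarrow> (edge \<Rightarrow> int) \<Rightarrow> (point + point) graph list" where
  "Res G1 G2 i1 i2 s t s' t' f1 f2 =
     (let \<sigma> = (if fst i1 = fst i2 then (\<lambda>p. p) else prod.swap);
          H2 = map \<sigma> G2; g2 = (\<lambda>e. f2 (\<sigma> ` e))
      in if crosses G1 H2 s t s' t' f1 g2
         then [disjoint_union (res3 G1 H2 t t') (res4 G1 H2 t t'),
               disjoint_union (res5 G1 H2 s s' f1 g2) (res6 G1 H2 t t' f1 g2)]
         else [disjoint_union (graph_of G1) (graph_of G2)])"


subsection \<open>Grafting\<close>

text \<open>
  The edge \<open>\<delta>\<^sub>3\<close> is the side \<open>\<delta>\<close> of the tile \<open>G_s\<close>. For \<open>s < d\<close> it is determined by \<open>G1\<close>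
  and \<open>s\<close>, for \<open>s = d\<close> it is a free choice.
\<close>

definition graft_defined :: "tile list \<Rightarrow> nat \<Rightarrow> side \<Rightarrow> bool" where
  "graft_defined G1 s \<delta> \<longleftrightarrow>
     (1 < s \<and> s < length G1 \<and> \<delta> = (if next_is_north G1 s then East else North)) \<or>
     (s = length G1 \<and> \<delta> \<in> {North, East})"

fun opposite_side :: "side \<Rightarrow> side" where
  "opposite_side North = South"
| "opposite_side South = North"
| "opposite_side East = West"
| "opposite_side West = East"

definition delta3 :: "tile list \<Rightarrow> nat \<Rightarrow> side \<Rightarrow> edge" where
  "delta3 G1 s \<delta> = side_edge \<delta> (nth_tile G1 s)"

definition delta3' :: "tile list \<Rightarrow> side \<Rightarrow> edge" where
  "delta3' G2 \<delta> = side_edge (opposite_side \<delta>) (nth_tile G2 1)"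

text \<open>The sign function \<open>f2\<close> is used only if \<open>s = d\<close>.\<close>

definition Graft ::
  "tile list \<Rightarrow> tile list \<Rightarrow> nat \<Rightarrow> side \<Rightarrow> (edge \<Rightarrow> int) \<Rightarrow> (edge \<Rightarrow> int) \<Rightarrow>
   (point + point) graph list" where
  "Graft G1 G2 s \<delta> f1 f2 =
     (let d = length G1;
          g3 = graph_of (glue (sub_snake G1 1 s) \<delta> G2 (opposite_side \<delta>))
      in if s < d then
           (let c = - f1 (interior_edge G1 s);
                g4 = final_piece (\<lambda>A. A) G1 f1 (s + 1) c;
                g5 = initial_piece (\<lambda>A. A) G1 f1 s c;
                A = rev_snake G2; B = sub_snake G1 (s + 1) d;
                g6 = graph_of (if next_is_north G1 s then glue A (rev_side South) B West
                               else glue A (rev_side West) B South)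
            in [disjoint_union g3 g4, disjoint_union g5 g6])
         else
           (let c = f1 (delta3 G1 s \<delta>);
                g4 = single_edge (delta3 G1 s \<delta>);
                g5 = initial_piece (\<lambda>A. A) G1 f1 d c;
                g6 = final_piece rev_snake G2 f2 1 c
            in [disjoint_union g3 g4, disjoint_union g5 g6]))"

end

theory Submission
  imports Defs
begin

text \<open>
  All sets of matchings here are finite, so the two bijections exist as soon as the numbers
  \<open>m\<close> of perfect matchings satisfy \<open>m(G1) m(G2) = m(G3) m(G4) + m(G5) m(G6)\<close>. This identity
  turns out to be a determinant identity for products of \<open>2 \<times> 2\<close> matrices.

  The north and the east edge of the last tile of a snake graph meet in a vertex of degree two,
  so every perfect matching contains exactly one of them. A sign function gives them
  opposite signs; let \<open>(p, q)\<close> be the numbers of matchings that contain the one of sign 1 and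
  the one of sign \<open>-1\<close>. If a further tile is glued on along an edge of sign \<open>c\<close>, then the
  matchings containing its far edge, of sign \<open>- c\<close>, correspond to all matchings of the old
  graph, and those containing its other free edge, of sign \<open>c\<close>, correspond to the old matchings
  containing the gluing edge (\<open>count_attach_square\<close>). Hence \<open>(p, q)\<close> becomes \<open>(p, p + q)\<close> if
  \<open>c = 1\<close> and \<open>(p + q, q)\<close> if \<open>c = -1\<close>. Therefore \<open>m(G)\<close> depends only on the word of signs
  of the interior edges, and is \<open>(1, 1) M (1, 1)\<^sup>T\<close> with \<open>M\<close> a product of unipotent
  matrices, one for each letter (\<open>count_graph_of\<close>). The matrices of the two letters are
  transposes of each other, so reversing a word and negating its letters transposes \<open>M\<close>.

  For an overlap the two words are \<open>a x b\<close> and \<open>a' x b'\<close> with a common middle part \<open>x\<close>, and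
  \<open>G3\<close>, \<open>G4\<close> have the words \<open>a x b'\<close> and \<open>a' x b\<close>. By the Cauchy-Binet formula, and because
  \<open>x\<close> contributes a matrix of determinant 1, the difference \<open>m(G1) m(G2) - m(G3) m(G4)\<close> is a
  product of two \<open>2 \<times> 2\<close> determinants, one formed from \<open>a, a'\<close> and one from \<open>b, b'\<close>
  (\<open>word_count_exchange\<close>). By maximality of the overlap, \<open>a\<close> and \<open>a'\<close> end with opposite letters
  if neither is empty. The first determinant is then \<open>\<plusminus> m\<close> of the word of \<open>G5\<close>; if one of the
  words is empty, it is up to sign a single coordinate of a row vector, which is \<open>m\<close> of the
  initial piece that defines \<open>G5\<close> (\<open>wedge_res5\<close>). The same holds for \<open>b, b'\<close> and \<open>G6\<close>
  (\<open>wedge_res6\<close>). The crossing condition says precisely that the two signs multiply to 1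
  (\<open>resolution_count\<close>). Grafting leads to analogous identities (\<open>word_count_graft_interior\<close>,
  \<open>word_count_graft_end\<close>).
\<close>

section \<open>Matchings of disjoint unions\<close>

abbreviation count :: "'v graph \<Rightarrow> int" where
  "count H \<equiv> int (card (Match H))"

lemma finite_Match: "finite (edges H) \<Longrightarrow> finite (Match H)"
  by (rule finite_subset[of _ "Pow (edges H)"]) (auto simp: Match_def)

lemma finite_edges_disjoint_union:
  "finite (edges H) \<Longrightarrow> finite (edges K) \<Longrightarrow> finite (edges (disjoint_union H K))"
  by (simp add: disjoint_union_def edges_def)

lemma Ex1_image: "inj f \<Longrightarrow> (\<exists>!e. \<exists>e0. e = f ` e0 \<and> Q e0) \<longleftrightarrow> (\<exists>!e0. Q e0)"
  by (smt (verit, best) inj_image_eq_iff)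

lemma ball_Plus: "(\<forall>v\<in>A <+> B. P v) \<longleftrightarrow> (\<forall>a\<in>A. P (Inl a)) \<and> (\<forall>b\<in>B. P (Inr b))"
  by auto

lemma Match_disjoint_union_iff:
  assumes "M \<subseteq> edges H" "N \<subseteq> edges K"
  shows "(`) Inl ` M \<union> (`) Inr ` N \<in> Match (disjoint_union H K) \<longleftrightarrow>
    M \<in> Match H \<and> N \<in> Match K"
proof -
  let ?U = "(`) Inl ` M \<union> (`) Inr ` N :: ('a + 'b) set set"
  have sub: "?U \<subseteq> edges (disjoint_union H K)"
    using assms by (auto simp: disjoint_union_def edges_def)
  have l: "(\<exists>!e. e \<in> ?U \<and> Inl v \<in> e) \<longleftrightarrow> (\<exists>!e. e \<in> M \<and> v \<in> e)" for v
  proof -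
    have "e \<in> ?U \<and> Inl v \<in> e \<longleftrightarrow> (\<exists>e0. e = Inl ` e0 \<and> e0 \<in> M \<and> v \<in> e0)" for e
      by auto
    then show ?thesis using Ex1_image[of Inl] by simp
  qed
  have r: "(\<exists>!e. e \<in> ?U \<and> Inr v \<in> e) \<longleftrightarrow> (\<exists>!e. e \<in> N \<and> v \<in> e)" for v
  proof -
    have "e \<in> ?U \<and> Inr v \<in> e \<longleftrightarrow> (\<exists>e0. e = Inr ` e0 \<and> e0 \<in> N \<and> v \<in> e0)" for e
      by auto
    then show ?thesis using Ex1_image[of Inr] by simp
  qed
  have v: "verts (disjoint_union H K) = verts H <+> verts K"
    by (simp add: disjoint_union_def verts_def)
  have "(\<forall>v\<in>verts (disjoint_union H K). \<exists>!e. e \<in> ?U \<and> v \<in> e) \<longleftrightarrow>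
     (\<forall>v\<in>verts H. \<exists>!e. e \<in> M \<and> v \<in> e) \<and> (\<forall>v\<in>verts K. \<exists>!e. e \<in> N \<and> v \<in> e)"
    unfolding v ball_Plus l r ..
  then show ?thesis
    by (simp only: Match_def mem_Collect_eq sub assms simp_thms)
qed

text \<open>
  An empty edge covers no vertex and could be added to a matching freely; it would moreover have
  the same image under both injections. This is why it has to be excluded.
\<close>

lemma count_disjoint_union:
  assumes "{} \<notin> edges H" "{} \<notin> edges K"
  shows "count (disjoint_union H K) = count H * count K"
proof -
  let ?h = "\<lambda>(M, N). (`) Inl ` M \<union> (`) Inr ` N :: ('a + 'b) set set"
  have "?h ` (Match H \<times> Match K) = Match (disjoint_union H K)"
  proof (intro equalityI subsetI)
    fix U assume "U \<in> ?h ` (Match H \<times> Match K)"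
    then obtain M N where "U = (`) Inl ` M \<union> (`) Inr ` N" "M \<in> Match H" "N \<in> Match K"
      by auto
    then show "U \<in> Match (disjoint_union H K)"
      using Match_disjoint_union_iff[of M H N K] by (auto simp: Match_def)
  next
    fix U assume U: "U \<in> Match (disjoint_union H K)"
    define M N where "M = {e \<in> edges H. Inl ` e \<in> U}" and "N = {e \<in> edges K. Inr ` e \<in> U}"
    have "U \<subseteq> (`) Inl ` edges H \<union> (`) Inr ` edges K"
      using U by (auto simp: Match_def disjoint_union_def edges_def)
    then have eq: "U = (`) Inl ` M \<union> (`) Inr ` N"
      unfolding M_def N_def by auto
    moreover have "M \<in> Match H \<and> N \<in> Match K"
      using U Match_disjoint_union_iff[of M H N K] unfolding eq[symmetric]
      by (auto simp: M_def N_def)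
    ultimately show "U \<in> ?h ` (Match H \<times> Match K)" by auto
  qed
  moreover have "inj_on ?h (Match H \<times> Match K)"
  proof -
    have "M = {e. e \<noteq> {} \<and> Inl ` e \<in> ?h (M, N)} \<and> N = {e. e \<noteq> {} \<and> Inr ` e \<in> ?h (M, N)}"
      if "M \<in> Match H" "N \<in> Match K" for M N
    proof -
      have "{} \<notin> M" "{} \<notin> N" using that assms by (auto simp: Match_def)
      moreover have "Inl ` e \<in> ?h (M, N) \<longleftrightarrow> e \<in> M" if "e \<noteq> {}" for e
      proof -
        have "Inl ` e \<notin> (`) Inr ` N" using that by auto
        then show ?thesis
          unfolding prod.case Un_iff by (simp add: inj_image_mem_iff inj_image_eq_iff inj_def)
      qed
      moreover have "Inr ` e \<in> ?h (M, N) \<longleftrightarrow> e \<in> N" if "e \<noteq> {}" for e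
      proof -
        have "Inr ` e \<notin> (`) Inl ` M" using that by auto
        then show ?thesis
          unfolding prod.case Un_iff by (simp add: inj_image_mem_iff inj_image_eq_iff inj_def)
      qed
      ultimately have "e \<in> M \<longleftrightarrow> e \<noteq> {} \<and> Inl ` e \<in> ?h (M, N)"
        "e' \<in> N \<longleftrightarrow> e' \<noteq> {} \<and> Inr ` e' \<in> ?h (M, N)" for e e'
        by - (cases "e = {}"; cases "e' = {}"; simp)+
      then show ?thesis by (simp only: set_eq_iff mem_Collect_eq simp_thms)
    qed
    then show ?thesis
      by (intro inj_on_inverseI[where g = "\<lambda>U. ({e. e \<noteq> {} \<and> Inl ` e \<in> U}, {e. e \<noteq> {} \<and> Inr ` e \<in> U})"])
        (simp only: mem_Times_iff prod_eq_iff fst_conv snd_conv case_prod_unfold)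
  qed
  ultimately have "card (Match (disjoint_union H K)) = card (Match H \<times> Match K)"
    by (metis card_image)
  then show ?thesis by (simp add: card_cartesian_product)
qed

lemma count_Match_list:
  assumes "\<And>H. H \<in> set Hs \<Longrightarrow> finite (edges H)"
  shows "finite (Match_list Hs)" "int (card (Match_list Hs)) = sum_list (map count Hs)"
proof -
  have fin: "finite (Match (Hs ! i))" if "i < length Hs" for i
    using that assms finite_Match nth_mem by blast
  then show "finite (Match_list Hs)"
    unfolding Match_list_def by (intro finite_SigmaI) auto
  have "card (Match_list Hs) = (\<Sum>i<length Hs. card (Match (Hs ! i)))"
    unfolding Match_list_def using fin by (intro card_SigmaI) auto
  then show "int (card (Match_list Hs)) = sum_list (map count Hs)"
    by (simp add: sum_list_sum_nth atLeast0LessThan)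
qed

text \<open>
  The graphs for which matchings are finite in number and multiplicative over disjoint unions.
\<close>

definition proper :: "'v graph \<Rightarrow> bool" where
  "proper H \<longleftrightarrow> finite (edges H) \<and> {} \<notin> edges H"

lemma count_disjoint_union_proper:
  "proper H \<Longrightarrow> proper K \<Longrightarrow> count (disjoint_union H K) = count H * count K"
  by (simp add: proper_def count_disjoint_union)

lemma bij_Match_list:
  assumes "finite (edges H)" "\<And>K. K \<in> set Ks \<Longrightarrow> finite (edges K)" "count H = sum_list (map count Ks)"
  shows "\<exists>\<phi>. bij_betw \<phi> (Match H) (Match_list Ks)"
  using assms count_Match_list[of Ks] by (intro finite_same_card_bij finite_Match) auto

lemma bij_Match_pair:
  assumes "proper H1" "proper H2" "proper H3" "proper H4" "proper H5" "proper H6"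
    and "count H1 * count H2 = count H3 * count H4 + count H5 * count H6"
  shows "\<exists>\<phi>. bij_betw \<phi> (Match (disjoint_union H1 H2))
    (Match_list [disjoint_union H3 H4, disjoint_union H5 H6])"
  using assms
  by (intro bij_Match_list) (auto simp: count_disjoint_union_proper proper_def intro!:
      finite_edges_disjoint_union)

section \<open>Attaching a square along an edge\<close>

text \<open>
  A square with vertices \<open>u, x, y, v\<close> is attached along its edge \<open>{u, v}\<close>. The new vertices \<open>x\<close>
  and \<open>y\<close> have degree two, so a matching contains either \<open>{x, y}\<close>, and the rest is a matching of
  the old graph, or both \<open>{u, x}\<close> and \<open>{y, v}\<close>; in the latter case replacing these two by
  \<open>{u, v}\<close> gives a matching of the old graph through \<open>{u, v}\<close>.
\<close>

lemma count_attach_square: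
  fixes u v x y :: 'v and V :: "'v set" and E :: "'v set set"
  defines "H \<equiv> (V, E)"
    and "H' \<equiv> (V \<union> {x, y}, E \<union> {{u, x}, {x, y}, {y, v}})"
  assumes "finite E" "\<Union> E \<subseteq> V" "{u, v} \<in> E" "u \<noteq> v" "x \<noteq> y" "x \<notin> V" "y \<notin> V"
  shows "card {M \<in> Match H'. {x, y} \<in> M} = card (Match H)" (is ?T1)
    and "card {M \<in> Match H'. {y, v} \<in> M} = card {M \<in> Match H. {u, v} \<in> M}" (is ?T2)
    and "card (Match H') = card (Match H) + card {M \<in> Match H. {u, v} \<in> M}" (is ?T3)
proof -
  have uv: "u \<in> V" "v \<in> V" "u \<noteq> x" "u \<noteq> y" "v \<noteq> x" "v \<noteq> y" using assms by auto
  have EV: "e \<subseteq> V" "x \<notin> e" "y \<notin> e" if "e \<in> E" for e using that assms by auto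
  have M_iff: "M \<in> Match H \<longleftrightarrow> M \<subseteq> E \<and> (\<forall>w\<in>V. \<exists>!e. e \<in> M \<and> w \<in> e)" for M
    by (simp add: Match_def H_def edges_def verts_def)
  have M'_iff: "M \<in> Match H' \<longleftrightarrow> M \<subseteq> E \<union> {{u, x}, {x, y}, {y, v}} \<and>
      (\<forall>w\<in>V. \<exists>!e. e \<in> M \<and> w \<in> e) \<and> (\<exists>!e. e \<in> M \<and> x \<in> e) \<and> (\<exists>!e. e \<in> M \<and> y \<in> e)" for M
    by (auto simp: Match_def H'_def edges_def verts_def)
  have new: "{u, x} \<notin> E" "{x, y} \<notin> E" "{y, v} \<notin> E" using EV by blast+
  have dist: "{u, x} \<noteq> {x, y}" "{x, y} \<noteq> {y, v}" "{u, x} \<noteq> {y, v}"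
    using uv assms by (auto simp: doubleton_eq_iff)
  have uniq: "e = e'" if "M \<in> Match H'" "e \<in> M" "e' \<in> M" "w \<in> e" "w \<in> e'" "w \<in> V \<union> {x, y}" for M e e' w
  proof -
    have "w \<in> V \<or> w = x \<or> w = y" using that(6) by auto
    then have "\<exists>!e. e \<in> M \<and> w \<in> e" using that(1) unfolding M'_iff by (elim disjE) simp_all
    then show ?thesis using that(2-5) by blast
  qed
  have split: "({x, y} \<in> M \<and> M - {{x, y}} \<subseteq> E) \<or>
     ({u, x} \<in> M \<and> {y, v} \<in> M \<and> {x, y} \<notin> M)" if M: "M \<in> Match H'" for M
  proof (cases "{x, y} \<in> M")
    case True
    then have "{u, x} \<notin> M" "{y, v} \<notin> M"
      using uniq[OF M, of "{x, y}" "{u, x}" x] uniq[OF M, of "{x, y}" "{y, v}" y] dist by auto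
    moreover have "M \<subseteq> E \<union> {{u, x}, {x, y}, {y, v}}" using M unfolding M'_iff by simp
    ultimately show ?thesis using True by blast
  next
    case False
    have "\<exists>!e. e \<in> M \<and> x \<in> e" "\<exists>!e. e \<in> M \<and> y \<in> e" using M unfolding M'_iff by simp_all
    then obtain e e' where "e \<in> M" "x \<in> e" "e' \<in> M" "y \<in> e'" by (elim ex1E conjE)
    have "M \<subseteq> E \<union> {{u, x}, {x, y}, {y, v}}" using M unfolding M'_iff by simp
    then have "e \<in> E \<or> e = {u, x} \<or> e = {x, y} \<or> e = {y, v}"
      "e' \<in> E \<or> e' = {u, x} \<or> e' = {x, y} \<or> e' = {y, v}"
      using \<open>e \<in> M\<close> \<open>e' \<in> M\<close> by blast+
    moreover have "e \<noteq> {x, y}" "e' \<noteq> {x, y}" "e \<notin> E" "e' \<notin> E"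
      using False \<open>e \<in> M\<close> \<open>e' \<in> M\<close> \<open>x \<in> e\<close> \<open>y \<in> e'\<close> EV(2)[of e] EV(3)[of e'] by blast+
    moreover have "e \<noteq> {y, v}" "e' \<noteq> {u, x}"
      using \<open>x \<in> e\<close> \<open>y \<in> e'\<close> uv \<open>x \<noteq> y\<close> by auto
    ultimately have "e = {u, x}" "e' = {y, v}" by blast+
    then show ?thesis using False \<open>e \<in> M\<close> \<open>e' \<in> M\<close> by auto
  qed
  have fin: "finite (Match H')"
    using \<open>finite E\<close> by (auto intro!: finite_Match simp: H_def H'_def edges_def)
  have "bij_betw (\<lambda>M. M - {{x, y}}) {M \<in> Match H'. {x, y} \<in> M} (Match H)"
  proof (rule bij_betw_byWitness[where f' = "insert {x, y}"])
    show "(\<lambda>M. M - {{x, y}}) ` {M \<in> Match H'. {x, y} \<in> M} \<subseteq> Match H"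
    proof clarify
      fix M assume M: "M \<in> Match H'" "{x, y} \<in> M"
      have "e \<in> M - {{x, y}} \<and> w \<in> e \<longleftrightarrow> e \<in> M \<and> w \<in> e" if "w \<in> V" for w e
        using that assms by auto
      then show "M - {{x, y}} \<in> Match H"
        using M split[OF M(1)] unfolding M_iff M'_iff by simp
    qed
    show "insert {x, y} ` Match H \<subseteq> {M \<in> Match H'. {x, y} \<in> M}"
    proof clarify
      fix M assume M: "M \<in> Match H"
      have "e \<in> insert {x, y} M \<and> w \<in> e \<longleftrightarrow> e \<in> M \<and> w \<in> e" if "w \<in> V" for w e
        using that assms by auto
      moreover have "e \<in> insert {x, y} M \<and> w \<in> e \<longleftrightarrow> e = {x, y}" if "w \<in> {x, y}" for w e
        using M that EV unfolding M_iff by auto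
      ultimately show "insert {x, y} M \<in> Match H' \<and> {x, y} \<in> insert {x, y} M"
        using M unfolding M_iff M'_iff by auto
    qed
  qed (use new in \<open>auto simp: M_iff\<close>)
  then show T1: ?T1 by (rule bij_betw_same_card)
  have "bij_betw (\<lambda>M. insert {u, v} (M - {{u, x}, {y, v}}))
     {M \<in> Match H'. {y, v} \<in> M} {M \<in> Match H. {u, v} \<in> M}"
  proof (rule bij_betw_byWitness[where f' = "\<lambda>M. M - {{u, v}} \<union> {{u, x}, {y, v}}"])
    have M1: "{u, v} \<notin> M" "{u, x} \<in> M" "M - {{u, x}, {y, v}} \<subseteq> E"
      if M: "M \<in> Match H'" "{y, v} \<in> M" for M
    proof -
      have "{u, v} \<noteq> {y, v}" using uv by (auto simp: doubleton_eq_iff)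
      then show "{u, v} \<notin> M" using uniq[OF M(1) _ M(2), of "{u, v}" v] uv by blast
      have xy: "{x, y} \<notin> M" using uniq[OF M(1) _ M(2), of "{x, y}" y] dist by blast
      then show "{u, x} \<in> M" using split[OF M(1)] by blast
      have "M \<subseteq> E \<union> {{u, x}, {x, y}, {y, v}}" using M unfolding M'_iff by simp
      then show "M - {{u, x}, {y, v}} \<subseteq> E" using xy by blast
    qed
    show "\<forall>M\<in>{M \<in> Match H'. {y, v} \<in> M}.
        insert {u, v} (M - {{u, x}, {y, v}}) - {{u, v}} \<union> {{u, x}, {y, v}} = M"
      using M1 by blast
    show "\<forall>M\<in>{M \<in> Match H. {u, v} \<in> M}.
        insert {u, v} (M - {{u, v}} \<union> {{u, x}, {y, v}} - {{u, x}, {y, v}}) = M"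
      using new unfolding M_iff by blast
    show "(\<lambda>M. insert {u, v} (M - {{u, x}, {y, v}})) ` {M \<in> Match H'. {y, v} \<in> M}
        \<subseteq> {M \<in> Match H. {u, v} \<in> M}"
    proof clarify
      fix M assume M: "M \<in> Match H'" "{y, v} \<in> M"
      have one: "\<exists>!e. e \<in> insert {u, v} (M - {{u, x}, {y, v}}) \<and> w \<in> e" if w: "w \<in> V" for w
      proof (cases "w = u \<or> w = v")
        case True
        then have "e \<in> M \<and> w \<in> e \<Longrightarrow> e = {u, x} \<or> e = {y, v}" for e
          using w uniq[OF M(1) _ M(2), of e v] uniq[OF M(1) _ M1(2)[OF M], of e u] by blast
        then show ?thesis using True by blast
      next
        case False
        then have "e \<in> insert {u, v} (M - {{u, x}, {y, v}}) \<and> w \<in> e \<longleftrightarrow> e \<in> M \<and> w \<in> e" for e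
          using w assms by auto
        then show ?thesis using w M unfolding M'_iff by simp
      qed
      then show "insert {u, v} (M - {{u, x}, {y, v}}) \<in> Match H \<and>
          {u, v} \<in> insert {u, v} (M - {{u, x}, {y, v}})"
        using M1(3)[OF M] \<open>{u, v} \<in> E\<close> unfolding M_iff by simp
    qed
    show "(\<lambda>M. M - {{u, v}} \<union> {{u, x}, {y, v}}) ` {M \<in> Match H. {u, v} \<in> M}
        \<subseteq> {M \<in> Match H'. {y, v} \<in> M}"
    proof clarify
      fix M assume M: "M \<in> Match H" "{u, v} \<in> M"
      let ?N = "M - {{u, v}} \<union> {{u, x}, {y, v}}"
      have one: "\<exists>!e. e \<in> ?N \<and> w \<in> e" if w: "w \<in> V" for w
      proof (cases "w = u \<or> w = v")
        case True
        then have "e \<in> M \<and> w \<in> e \<Longrightarrow> e = {u, v}" for e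
          using w M unfolding M_iff by (auto simp: Ex1_def)
        then show ?thesis using True uv \<open>u \<noteq> v\<close> by blast
      next
        case False
        then have "e \<in> ?N \<and> w \<in> e \<longleftrightarrow> e \<in> M \<and> w \<in> e" for e
          using w assms by auto
        then show ?thesis using w M unfolding M_iff by simp
      qed
      have "e \<in> ?N \<and> x \<in> e \<longleftrightarrow> e = {u, x}" "e \<in> ?N \<and> y \<in> e \<longleftrightarrow> e = {y, v}" for e
        using M EV uv \<open>x \<noteq> y\<close> unfolding M_iff by auto
      then have "\<exists>!e. e \<in> ?N \<and> x \<in> e" "\<exists>!e. e \<in> ?N \<and> y \<in> e" by simp_all
      moreover have "?N \<subseteq> E \<union> {{u, x}, {x, y}, {y, v}}" using M unfolding M_iff by blast
      moreover have "\<forall>w\<in>V. \<exists>!e. e \<in> ?N \<and> w \<in> e" by (intro ballI one)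
      ultimately show "?N \<in> Match H' \<and> {y, v} \<in> ?N" unfolding M'_iff by simp
    qed
  qed
  then show T2: ?T2 by (rule bij_betw_same_card)
  have "Match H' = {M \<in> Match H'. {x, y} \<in> M} \<union> {M \<in> Match H'. {y, v} \<in> M}"
    using split by blast
  moreover have "{M \<in> Match H'. {x, y} \<in> M} \<inter> {M \<in> Match H'. {y, v} \<in> M} = {}"
    using dist uniq[of _ "{x, y}" "{y, v}" y] by auto
  ultimately show ?T3
    using fin by (metis (no_types, lifting) T1 T2 card_Un_disjoint finite_Un)
qed

section \<open>Words of signs\<close>

text \<open>
  Multiplication of a row vector by the matrix of the letter \<open>c\<close>: coordinate \<open>c\<close> is kept and
  the other one is replaced by the sum.
\<close>

definition sign_step :: "int \<Rightarrow> int \<times> int \<Rightarrow> int \<times> int" where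
  "sign_step c p = (if c = 1 then (fst p, fst p + snd p) else (fst p + snd p, snd p))"

text \<open>
  The coordinates of row vectors are indexed by signs, the first one by 1.
\<close>

definition component :: "int \<Rightarrow> int \<times> int \<Rightarrow> int" where
  "component c p = (if c = 1 then fst p else snd p)"

definition word_vec :: "int list \<Rightarrow> int \<times> int" where
  "word_vec w = fold sign_step w (1, 1)"

definition word_count :: "int list \<Rightarrow> int" where
  "word_count w = fst (word_vec w) + snd (word_vec w)"

text \<open>
  The word whose matrix is the transpose of the matrix of \<open>w\<close>, as the matrices of \<open>c\<close> and
  \<open>- c\<close> are transposes of each other.
\<close>

definition dual_word :: "int list \<Rightarrow> int list" where
  "dual_word w = map uminus (rev w)"

definition dot :: "int \<times> int \<Rightarrow> int \<times> int \<Rightarrow> int" where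
  "dot p q = fst p * fst q + snd p * snd q"

definition wedge :: "int \<times> int \<Rightarrow> int \<times> int \<Rightarrow> int" where
  "wedge p q = fst p * snd q - snd p * fst q"

abbreviation sign_word :: "int list \<Rightarrow> bool" where
  "sign_word w \<equiv> set w \<subseteq> {1, -1}"

lemma dual_word_simps [simp]: "dual_word [] = []" "dual_word (c # w) = dual_word w @ [- c]"
    "dual_word (u @ w) = dual_word w @ dual_word u"
  "dual_word (dual_word w) = w"
  by (simp_all add: dual_word_def rev_map o_def)

lemma sign_word_dual_word [simp]: "sign_word w \<Longrightarrow> sign_word (dual_word w)"
  by (auto simp: dual_word_def)

lemma word_vec_Nil [simp]: "word_vec [] = (1, 1)"
  by (simp add: word_vec_def)

lemma word_vec_snoc [simp]: "word_vec (w @ [c]) = sign_step c (word_vec w)"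
  by (simp add: word_vec_def)

lemma dot_sign_step: "c \<in> {1, -1} \<Longrightarrow> dot (sign_step c p) q = dot p (sign_step (- c) q)"
  by (auto simp: dot_def sign_step_def algebra_simps)

text \<open>
  The matrices of the letters have determinant 1.
\<close>

lemma wedge_sign_step: "wedge (sign_step c p) (sign_step c q) = wedge p q"
  by (simp add: wedge_def sign_step_def algebra_simps)

text \<open>
  The letters of \<open>w\<close> are moved one by one to the other side of the inner product, where they act
  by their transposes.
\<close>

lemma word_count_append: "sign_word (u @ w) \<Longrightarrow> word_count (u @ w)
    = dot (word_vec u) (word_vec (dual_word w))"
proof (induction w arbitrary: u)
  case Nil
  then show ?case by (simp add: word_count_def dot_def)
next
  case (Cons c w)
  have "word_count (u @ c # w) = dot (word_vec (u @ [c])) (word_vec (dual_word w))"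
    using Cons.IH[of "u @ [c]"] Cons.prems by simp
  then show ?case using Cons.prems by (simp add: dot_sign_step)
qed

lemma wedge_word_vec_append: "wedge (word_vec (u @ w)) (word_vec (u' @ w))
    = wedge (word_vec u) (word_vec u')"
  by (induction w rule: rev_induct) (simp_all flip: append_assoc add: wedge_sign_step)

lemma word_count_dual_word: "sign_word w \<Longrightarrow> word_count (dual_word w) = word_count w"
  using word_count_append[of "[]" w] by (simp add: dot_def word_count_def)

lemma word_vec_uminus: "sign_word w \<Longrightarrow> word_vec (map uminus w) = prod.swap (word_vec w)"
  by (induction w rule: rev_induct) (auto simp: sign_step_def)

lemma word_count_uminus: "sign_word w \<Longrightarrow> word_count (map uminus w) = word_count w"
  by (simp add: word_count_def word_vec_uminus)

lemma word_count_rev: "sign_word w \<Longrightarrow> word_count (rev w) = word_count w"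
  using word_count_uminus[of "rev w"] word_count_dual_word[of w] by (simp add: dual_word_def)

text \<open>
  Coordinate \<open>c\<close> is unchanged by the letter \<open>c\<close> and becomes the sum of the coordinates, which is
  the count of the word read so far, at each letter \<open>- c\<close>. So it is the count of the part of the
  word before the last \<open>- c\<close>, and the initial value 1 if there is none. This is the
  rule by which initial pieces are cut off.
\<close>

lemma component_word_vec_notin:
  "sign_word w \<Longrightarrow> c \<in> {1, -1} \<Longrightarrow> - c \<notin> set w \<Longrightarrow> component c (word_vec w) = 1"
  by (induction w rule: rev_induct) (auto simp: component_def sign_step_def)

lemma component_word_vec_split:
  "sign_word w \<Longrightarrow> c \<in> {1, -1} \<Longrightarrow> - c \<notin> set w \<Longrightarrow> component c (word_vec (u @ (- c) # w)) = word_count u"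
proof (induction w rule: rev_induct)
  case Nil
  then show ?case by (auto simp: component_def sign_step_def word_count_def)
next
  case (snoc x w)
  then have "x = c" by auto
  then have "component c (word_vec ((u @ - c # w) @ [x])) = component c (word_vec (u @ - c # w))"
    unfolding word_vec_snoc by (simp add: component_def sign_step_def)
  then show ?case using snoc by simp
qed

text \<open>
  With \<open>M\<^sub>c\<close> the matrix of \<open>c\<close> and \<open>J\<close> that of the determinant form, this is the identity
  \<open>M\<^sub>c J M\<^sub>c = - c M\<^sub>-\<^sub>c\<close>. It explains why \<open>G5\<close> and \<open>G6\<close> are glued along an edge of
  the opposite sign.
\<close>

lemma wedge_word_vec_snoc:
  assumes "sign_word a" "sign_word a'" "c \<in> {1, -1}"
  shows "wedge (word_vec (a @ [c])) (word_vec (a' @ [- c])) = - c * word_count (a @ [- c] @ dual_word a')"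
proof -
  have "word_count ((a @ [- c]) @ dual_word a') = dot (word_vec (a @ [- c])) (word_vec a')"
    using assms word_count_append[of "a @ [- c]" "dual_word a'"] by auto
  then show ?thesis using assms(3) by (auto simp: wedge_def dot_def sign_step_def algebra_simps)
qed

lemma wedge_word_vec_Nil:
  assumes "c \<in> {1, -1}"
  shows "wedge (word_vec (a @ [c])) (word_vec []) = - c * component (- c) (word_vec a)"
  using assms by (auto simp: wedge_def sign_step_def component_def)

lemma wedge_swap: "wedge p q = - wedge q p"
  by (simp add: wedge_def)

text \<open>
  Cauchy-Binet for the row vectors of \<open>a x, a' x\<close> and the column vectors of \<open>b, b'\<close>; the
  determinant on the left factor does not see \<open>x\<close>.
\<close>

lemma word_count_exchange:
  assumes "sign_word (a @ x @ b)" "sign_word (a' @ x @ b')"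
  shows "word_count (a @ x @ b) * word_count (a' @ x @ b') =
    word_count (a @ x @ b') * word_count (a' @ x @ b) + wedge (word_vec a) (word_vec a')
        * wedge (word_vec (dual_word b)) (word_vec (dual_word b'))"
proof -
  have binet_cauchy: "dot p q * dot p' q' = dot p q' * dot p' q + wedge p p' * wedge q q'" for p q p' q'
    by (simp add: dot_def wedge_def algebra_simps)
  have eq: "word_count (u @ x @ w) = dot (word_vec (u @ x)) (word_vec (dual_word w))" if
      "sign_word (u @ x @ w)" for u w
    using word_count_append[of "u @ x" w] that by simp
  have "sign_word (a @ x @ b')" "sign_word (a' @ x @ b)" using assms by auto
  then show ?thesis
    using binet_cauchy[of "word_vec (a @ x)" "word_vec (dual_word b)" "word_vec (a' @ x)"
        "word_vec (dual_word b')"] assms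
    by (simp only: eq wedge_word_vec_append[of a x a'])
qed

text \<open>
  After expressing all counts through the vectors of \<open>a\<close>, of the dual of \<open>b\<close> and of the dual of
  \<open>y\<close>, this is a trilinear identity in three vectors of the plane.
\<close>

lemma word_count_graft_interior:
  assumes "sign_word a" "sign_word b" "sign_word y" "c \<in> {1, -1}"
  shows "word_count (a @ [c] @ b) * word_count y =
    word_count (a @ [- c] @ y) * component (- c) (word_vec (dual_word b)) + component c (word_vec a)
        * word_count (dual_word y @ [- c] @ b)"
proof -
  have "word_count (a @ [c] @ b) = dot (word_vec (a @ [c])) (word_vec (dual_word b))"
    "word_count (a @ [- c] @ y) = dot (word_vec (a @ [- c])) (word_vec (dual_word y))"
    "word_count (dual_word y @ [- c] @ b) = dot (word_vec (dual_word y @ [- c])) (word_vec (dual_word b))"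
    using assms word_count_append[of "a @ [c]" b] word_count_append[of "a @ [- c]" y]
      word_count_append[of "dual_word y @ [- c]" b] by auto
  moreover have "word_count y = fst (word_vec (dual_word y)) + snd (word_vec (dual_word y))"
    using assms word_count_dual_word[of y] by (simp add: word_count_def)
  ultimately show ?thesis
    using assms(4) by (auto simp: dot_def component_def sign_step_def algebra_simps)
qed

lemma word_count_graft_end:
  assumes "sign_word a" "sign_word y" "c \<in> {1, -1}"
  shows "word_count a * word_count y = word_count (a @ [c] @ y) + component (- c) (word_vec a)
      * component c (word_vec (dual_word y))"
proof -
  have "word_count (a @ [c] @ y) = dot (word_vec (a @ [c])) (word_vec (dual_word y))"
    using assms word_count_append[of "a @ [c]" y] by auto
  moreover have "word_count y = fst (word_vec (dual_word y)) + snd (word_vec (dual_word y))"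
    using assms word_count_dual_word[of y] by (simp add: word_count_def)
  ultimately show ?thesis
    using assms(3) by (auto simp: word_count_def[of a] dot_def component_def sign_step_def algebra_simps)
qed

section \<open>Snake graphs as staircases of tiles\<close>

text \<open>
  The two possible positions of consecutive tiles. A nonempty list of tiles is a snake graph if and
  only if consecutive tiles are in one of them: all further conditions follow because the sum of
  the coordinates increases by 1 in each step.
\<close>

abbreviation adjacent :: "tile \<Rightarrow> tile \<Rightarrow> bool" where
  "adjacent S T \<equiv> T = S + (0, 1) \<or> T = S + (1, 0)"

definition staircase :: "tile list \<Rightarrow> bool" where
  "staircase G \<longleftrightarrow> G \<noteq> [] \<and> successively adjacent G"

text \<open>
  The value is arbitrary for tiles that are not adjacent.
\<close>

definition shared_edge :: "tile \<Rightarrow> tile \<Rightarrow> edge" where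
  "shared_edge S T = (if T = S + (0, 1) then side_edge North S else side_edge East S)"

fun signs :: "(edge \<Rightarrow> int) \<Rightarrow> tile list \<Rightarrow> int list" where
  "signs f (S # T # G) = f (shared_edge S T) # signs f (T # G)"
| "signs f G = []"

lemma side_edge_eq_iff:
  "side_edge North S = side_edge South T \<longleftrightarrow> T = S + (0, 1)"
  "side_edge East S = side_edge West T \<longleftrightarrow> T = S + (1, 0)"
  by (cases S; cases T; auto simp: doubleton_eq_iff)+

lemma side_edge_adjacent [simp]:
  "side_edge South (S + (0, 1)) = side_edge North S" "side_edge West (S + (1, 0)) = side_edge East S"
  by (metis side_edge_eq_iff)+

lemma next_is_north_iff: "next_is_north G i \<longleftrightarrow> nth_tile G (i + 1) = nth_tile G i + (0, 1)"
  unfolding next_is_north_def side_edge_eq_iff ..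

lemma next_is_east_iff: "next_is_east G i \<longleftrightarrow> nth_tile G (i + 1) = nth_tile G i + (1, 0)"
  unfolding next_is_east_def side_edge_eq_iff ..

lemma interior_edge_eq: "interior_edge G i = shared_edge (nth_tile G i) (nth_tile G (i + 1))"
  by (simp add: interior_edge_def shared_edge_def next_is_north_iff)

lemma side_edge_in_tile_edges: "side_edge a T \<in> tile_edges T"
  by (cases a) (simp_all add: tile_edges_def)

lemma tile_verts_eq:
  "tile_verts T = {T, T + (1, 0), T + (0, 1), T + (1, 1)}"
  by (cases T) (auto simp: tile_verts_def tile_edges_def)

lemma staircase_append:
  "staircase (A @ B) \<longleftrightarrow> (if A = [] then staircase B else if B = [] then staircase A
     else staircase A \<and> staircase B \<and> adjacent (last A) (hd B))"
  by (auto simp: staircase_def successively_append_iff)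

lemma staircase_take:
  assumes "staircase G" "0 < n"
  shows "staircase (take n G)"
proof -
  have "successively adjacent (take n G @ drop n G)" using assms(1) by (simp add: staircase_def)
  then have "successively adjacent (take n G)" unfolding successively_append_iff by (rule conjunct1)
  then show ?thesis using assms by (simp add: staircase_def)
qed

lemma staircase_drop:
  assumes "staircase G" "n < length G"
  shows "staircase (drop n G)"
proof -
  have "successively adjacent (take n G @ drop n G)" using assms(1) by (simp add: staircase_def)
  then have "successively adjacent (drop n G)"
    unfolding successively_append_iff by (elim conjE)
  then show ?thesis using assms by (simp add: staircase_def)
qed

lemma staircase_nth:
  assumes "staircase G" "Suc i < length G"
  shows "adjacent (G ! i) (G ! Suc i)"
  using assms unfolding staircase_def by (simp add: successively_conv_nth)

lemma staircase_height:
  assumes "staircase G" "i \<le> j" "j < length G"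
  shows "fst (G ! j) + snd (G ! j) = fst (G ! i) + snd (G ! i) + int (j - i)"
  using assms(2,3)
proof (induction j rule: dec_induct)
  case (step j)
  then show ?case using staircase_nth[OF assms(1), of j] by auto
qed simp

lemma staircase_le_last:
  "staircase G \<Longrightarrow> S \<in> set G \<Longrightarrow> fst S \<le> fst (last G) \<and> snd S \<le> snd (last G)"
proof (induction G rule: rev_induct)
  case (snoc T G)
  then show ?case by (auto simp: staircase_append split: if_splits)
qed (simp add: staircase_def)

lemma card_shared_edge:
  assumes "adjacent S T"
  shows "card (tile_edges S \<inter> tile_edges T) = 1"
proof -
  have "tile_edges S \<inter> tile_edges T = {shared_edge S T}"
    using assms by (cases S) (elim disjE; simp add: tile_edges_def shared_edge_def doubleton_eq_iff
        Int_insert_left)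
  then show ?thesis by simp
qed

lemma snake_graph_imp_staircase:
  assumes "snake_graph G"
  shows "staircase G"
proof -
  have "adjacent (G ! i) (G ! Suc i)" if "Suc i < length G" for i
  proof -
    have "1 \<le> Suc i \<and> Suc i < length G" using that by simp
    then have "next_is_north G (Suc i) \<or> next_is_east G (Suc i)"
      using assms unfolding snake_graph_def by blast
    then show ?thesis by (simp add: next_is_north_iff next_is_east_iff nth_tile_def)
  qed
  then show ?thesis using assms by (auto simp: staircase_def snake_graph_def successively_conv_nth)
qed

text \<open>
  The height of a point is the sum of its coordinates. The edges of a tile of height \<open>h\<close> join
  heights \<open>h, h + 1\<close> or \<open>h + 1, h + 2\<close>, which separates tiles whose indices differ by 2 or more.
\<close>

lemma staircase_imp_snake_graph:
  assumes "staircase G"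
  shows "snake_graph G"
proof -
  let ?h = "\<lambda>p :: point. fst p + snd p"
  have edge: "?h ` e = {?h T, ?h T + 1} \<or> ?h ` e = {?h T + 1, ?h T + 2}" if "e \<in> tile_edges T" for e T
    using that by (cases T) (auto simp: tile_edges_def)
  have vert: "?h T \<le> ?h p \<and> ?h p \<le> ?h T + 2" if "p \<in> tile_verts T" for p T
    using that by (auto simp: tile_verts_eq)
  have height: "?h (nth_tile G j) = ?h (nth_tile G i) + int (j - i)"
    if "1 \<le> i" "i \<le> j" "j \<le> length G" for i j
    using staircase_height[OF assms, of "i - 1" "j - 1"] that by (simp add: nth_tile_def)
  have adj: "adjacent (nth_tile G i) (nth_tile G (i + 1))" if "1 \<le> i" "i < length G" for i
    using staircase_nth[OF assms, of "i - 1"] that by (simp add: nth_tile_def)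
  show ?thesis
    unfolding snake_graph_def
  proof (intro conjI allI impI)
    show "1 \<le> length G" using assms by (cases G) (auto simp: staircase_def)
  next
    fix i assume "1 \<le> i \<and> i < length G"
    then show "card (tile_edges (nth_tile G i) \<inter> tile_edges (nth_tile G (i + 1))) = 1"
      "next_is_north G i \<or> next_is_east G i"
      using adj[of i] card_shared_edge by (auto simp: next_is_north_iff next_is_east_iff)
  next
    fix i j assume ij: "1 \<le> i \<and> i + 2 \<le> j \<and> j \<le> length G"
    then have "?h (nth_tile G j) \<ge> ?h (nth_tile G i) + 2" using height[of i j] by auto
    then show "tile_edges (nth_tile G i) \<inter> tile_edges (nth_tile G j) = {}"
      using edge[of _ "nth_tile G i"] edge[of _ "nth_tile G j"] by (fastforce simp: doubleton_eq_iff)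
  next
    fix i j assume ij: "1 \<le> i \<and> i + 3 \<le> j \<and> j \<le> length G"
    then have "?h (nth_tile G j) \<ge> ?h (nth_tile G i) + 3" using height[of i j] by auto
    then show "tile_verts (nth_tile G i) \<inter> tile_verts (nth_tile G j) = {}"
      using vert[of _ "nth_tile G i"] vert[of _ "nth_tile G j"] by fastforce
  qed
qed

section \<open>Appending a tile\<close>

lemma graph_of_snoc:
  "verts (graph_of (G @ [T])) = verts (graph_of G) \<union> tile_verts T"
  "edges (graph_of (G @ [T])) = edges (graph_of G) \<union> tile_edges T"
  by (auto simp: graph_of_def verts_def edges_def)

lemma finite_edges_graph_of: "finite (edges (graph_of G))"
  by (auto simp: graph_of_def edges_def tile_edges_def)

lemma empty_notin_edges_graph_of: "{} \<notin> edges (graph_of G)"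
  by (auto simp: graph_of_def edges_def tile_edges_def)

lemma count_single_edge:
  assumes "e \<noteq> {}"
  shows "count (single_edge e) = 1"
proof -
  have "Match (single_edge e) = {{e}}"
    using assms by (auto simp: Match_def single_edge_def verts_def edges_def)
  then show ?thesis by simp
qed

lemma finite_edges_single_edge: "finite (edges (single_edge e))"
  by (simp add: single_edge_def edges_def)

lemma empty_notin_edges_single_edge: "e \<noteq> {} \<Longrightarrow> {} \<notin> edges (single_edge e)"
  by (simp add: single_edge_def edges_def)

lemma proper_graph_of: "proper (graph_of G)"
  by (simp add: proper_def finite_edges_graph_of empty_notin_edges_graph_of)

lemma proper_single_edge: "e \<noteq> {} \<Longrightarrow> proper (single_edge e)"
  by (simp add: proper_def finite_edges_single_edge empty_notin_edges_single_edge)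

text \<open>
  The reflection in a line of slope 1. For a north or east side it is also the other free side of
  a last tile.
\<close>

fun partner :: "side \<Rightarrow> side" where
  "partner North = East" | "partner East = North"
| "partner South = West" | "partner West = South"

fun shift :: "side \<Rightarrow> point" where
  "shift North = (0, 1)" | "shift East = (1, 0)"
| "shift South = (0, -1)" | "shift West = (-1, 0)"

text \<open>
  The new vertices of the appended tile lie strictly to the north or strictly to the east of
  everything else, so that the tile is a square attached along the shared edge.
\<close>

lemma count_snoc:
  fixes G :: "tile list" and a :: side
  assumes G: "staircase G" and a: "a \<in> {North, East}"
  defines "S \<equiv> last G"
  defines "T \<equiv> S + shift a"
  shows "card {M \<in> Match (graph_of (G @ [T])). side_edge a T \<in> M} = card (Match (graph_of G))"
    and "card {M \<in> Match (graph_of (G @ [T])). side_edge (partner a) T \<in> M} =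
      card {M \<in> Match (graph_of G). side_edge a S \<in> M}"
    and "card (Match (graph_of (G @ [T]))) =
      card (Match (graph_of G)) + card {M \<in> Match (graph_of G). side_edge a S \<in> M}"
proof -
  define u where "u = lower_left_end a S"
  define v where "v = S + (1, 1)"
  define x where "x = u + shift a"
  define y where "y = v + shift a"
  let ?V = "verts (graph_of G)" and ?E = "edges (graph_of G)"
  have S: "S \<in> set G" using G by (simp add: S_def staircase_def)
  obtain m n where mn: "S = (m, n)" by (cases S)
  have bound: "fst p \<le> m + 1 \<and> snd p \<le> n + 1" if "p \<in> ?V" for p
  proof -
    obtain T where "T \<in> set G" "p \<in> tile_verts T" using \<open>p \<in> ?V\<close> by (auto simp: graph_of_def verts_def)
    then show ?thesis using staircase_le_last[OF G, of T] mn by (auto simp: tile_verts_eq S_def)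
  qed
  have xy: "x \<notin> ?V" "y \<notin> ?V" "x \<noteq> y" "u \<noteq> v"
    using bound[of x] bound[of y] a mn by (auto simp: x_def y_def u_def v_def)
  have E: "\<Union> ?E \<subseteq> ?V" by (auto simp: graph_of_def edges_def verts_def tile_verts_def)
  have uv: "side_edge a S = {u, v}" and sides: "side_edge a T = {x, y}" "side_edge (partner a) T = {y, v}"
    using a mn by (auto simp: u_def v_def x_def y_def T_def)
  have "tile_edges S \<subseteq> ?E" using S by (auto simp: graph_of_def edges_def)
  then have uvE: "{u, v} \<in> ?E" unfolding uv[symmetric] using side_edge_in_tile_edges by blast
  then have uvV: "u \<in> ?V" "v \<in> ?V" using E by auto
  have TV: "tile_verts T = {u, v, x, y}"
    using a mn by (auto simp: u_def v_def x_def y_def T_def tile_verts_eq)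
  have "a = North \<Longrightarrow> side_edge West T = {u, x} \<and> side_edge South T = {u, v}"
    "a = East \<Longrightarrow> side_edge South T = {u, x} \<and> side_edge West T = {u, v}"
    using mn by (auto simp: u_def v_def x_def y_def T_def)
  then have TE: "tile_edges T = {{u, x}, {x, y}, {y, v}, {u, v}}"
    using a sides unfolding tile_edges_def by (elim insertE emptyE) (simp_all add: insert_commute)
  have "verts (graph_of (G @ [T])) = ?V \<union> {x, y}"
    "edges (graph_of (G @ [T])) = ?E \<union> {{u, x}, {x, y}, {y, v}}"
    using uvE uvV unfolding graph_of_snoc TV TE by blast+
  then have H': "graph_of (G @ [T]) = (?V \<union> {x, y}, ?E \<union> {{u, x}, {x, y}, {y, v}})"
    by (simp add: verts_def edges_def prod_eq_iff)
  have H: "graph_of G = (?V, ?E)" by (simp add: verts_def edges_def)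
  note attach = count_attach_square[OF finite_edges_graph_of E uvE xy(4,3,1,2), folded H H']
  show "card {M \<in> Match (graph_of (G @ [T])). side_edge a T \<in> M} = card (Match (graph_of G))"
    and "card {M \<in> Match (graph_of (G @ [T])). side_edge (partner a) T \<in> M} =
      card {M \<in> Match (graph_of G). side_edge a S \<in> M}"
    and "card (Match (graph_of (G @ [T]))) =
      card (Match (graph_of G)) + card {M \<in> Match (graph_of G). side_edge a S \<in> M}"
    unfolding sides uv by (fact attach)+
qed

text \<open>
  A tile is a square attached to the graph consisting of its south edge.
\<close>

lemma count_single_tile:
  "card {M \<in> Match (graph_of [T]). side_edge North T \<in> M} = 1"
  "card {M \<in> Match (graph_of [T]). side_edge East T \<in> M} = 1"
  "card (Match (graph_of [T])) = 2"
proof -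
  obtain m n where T: "T = (m, n)" by (cases T)
  define u v x y where "u = (m, n)" and "v = (m + 1, n)" and "x = (m, n + 1)" and "y = (m + 1, n + 1)"
  note defs = u_def v_def x_def y_def
  have H': "graph_of [T] = ({u, v} \<union> {x, y}, {{u, v}} \<union> {{u, x}, {x, y}, {y, v}})"
    by (auto simp: graph_of_def tile_verts_eq tile_edges_def T defs)
  have "Match ({u, v}, {{u, v}}) = {{{u, v}}}"
    by (auto simp: Match_def verts_def edges_def)
  moreover from this have "{M \<in> Match ({u, v}, {{u, v}}). {u, v} \<in> M} = {{{u, v}}}"
    by (simp only:) blast
  ultimately have H: "card (Match ({u, v}, {{u, v}})) = 1"
    "card {M \<in> Match ({u, v}, {{u, v}}). {u, v} \<in> M} = 1" by simp_all
  have sides: "side_edge North T = {x, y}" "side_edge East T = {y, v}"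
    by (auto simp: defs T)
  have "u \<noteq> v" "x \<noteq> y" "x \<notin> {u, v}" "y \<notin> {u, v}" by (auto simp: defs)
  note attach = count_attach_square[of "{{u, v}}" "{u, v}" u v x y, OF _ _ _ this, folded H', unfolded H]
  show "card {M \<in> Match (graph_of [T]). side_edge North T \<in> M} = 1"
    "card {M \<in> Match (graph_of [T]). side_edge East T \<in> M} = 1"
    "card (Match (graph_of [T])) = 2"
    unfolding sides using attach by simp_all
qed

section \<open>Counting the matchings of a snake graph\<close>

text \<open>
  The conditions on a sign function are local; this is the part of them that concerns one tile.
\<close>

definition tile_signed :: "(edge \<Rightarrow> int) \<Rightarrow> tile \<Rightarrow> bool" where
  "tile_signed f T \<longleftrightarrow> f (side_edge North T) \<in> {1, -1} \<and>
     f (side_edge West T) = f (side_edge North T) \<and>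
     f (side_edge South T) = - f (side_edge North T) \<and>
     f (side_edge East T) = - f (side_edge North T)"

lemma sign_function_iff: "sign_function f G \<longleftrightarrow> (\<forall>T\<in>set G. tile_signed f T)"
proof -
  have "edges (graph_of G) = (\<Union>T\<in>set G. tile_edges T)" by (simp add: edges_def graph_of_def)
  then show ?thesis unfolding sign_function_def tile_signed_def tile_edges_def by auto
qed

lemma tile_signedD:
  assumes "tile_signed f T"
  shows "f (side_edge a T) \<in> {1, -1}" "f (side_edge South T) = - f (side_edge North T)"
    "f (side_edge East T) = - f (side_edge North T)" "f (side_edge West T) = f (side_edge North T)"
  using assms by (cases a; auto simp: tile_signed_def)+

lemma signs_append:
  "A \<noteq> [] \<Longrightarrow> B \<noteq> [] \<Longrightarrow>
   signs f (A @ B) = signs f A @ f (shared_edge (last A) (hd B)) # signs f B"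
proof (induction f A rule: signs.induct)
  case ("2_2" f T)
  then show ?case by (cases B) auto
qed auto

lemma length_signs [simp]: "length (signs f G) = length G - 1"
  by (induction f G rule: signs.induct) auto

lemma signs_take: "signs f (take n G) = take (n - 1) (signs f G)"
proof (cases "0 < n \<and> n < length G")
  case True
  then have "signs f G = signs f (take n G) @ f (shared_edge (last (take n G)) (hd (drop n G))) # signs
      f (drop n G)"
    using signs_append[of "take n G" "drop n G" f] True by (cases G) auto
  then show ?thesis using True by (simp add: min_def)
next
  case False
  then show ?thesis by auto
qed

lemma signs_drop: "signs f (drop n G) = drop n (signs f G)"
proof (cases "0 < n \<and> n < length G")
  case True
  then have "signs f G = signs f (take n G) @ f (shared_edge (last (take n G)) (hd (drop n G))) # signs
      f (drop n G)"
    using signs_append[of "take n G" "drop n G" f] True by (cases G) auto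
  then show ?thesis using True by (simp add: min_def)
next
  case False
  then show ?thesis by auto
qed

lemma nth_signs: "Suc i < length G \<Longrightarrow> signs f G ! i = f (shared_edge (G ! i) (G ! Suc i))"
proof (induction f G arbitrary: i rule: signs.induct)
  case (1 f S T G)
  then show ?case by (cases i) auto
qed auto

lemma nth_signs_interior:
  "1 \<le> i \<Longrightarrow> i < length G \<Longrightarrow> f (interior_edge G i) = signs f G ! (i - 1)"
  by (simp add: interior_edge_eq nth_tile_def nth_signs)

lemma sign_word_signs:
  "sign_function f G \<Longrightarrow> sign_word (signs f G)"
  by (induction f G rule: signs.induct)
    (auto simp: sign_function_iff shared_edge_def dest: tile_signedD(1))

lemma signs_cong:
  "(\<And>T a. T \<in> set G \<Longrightarrow> f (side_edge a T) = g (side_edge a T)) \<Longrightarrow> signs f G = signs g G"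
  by (induction f G rule: signs.induct) (auto simp: shared_edge_def)

text \<open>
  The induction needs the refined count: the two coordinates of the row vector count the
  matchings through the north and the east edge of the last tile, each indexed by its sign.
\<close>

lemma count_graph_of_aux:
  assumes "staircase G" "sign_function f G"
  shows "(\<forall>a\<in>{North, East}. int (card {M \<in> Match (graph_of G). side_edge a (last G) \<in> M}) =
       component (f (side_edge a (last G))) (word_vec (signs f G))) \<and>
     count (graph_of G) = word_count (signs f G)"
  using assms
proof (induction G rule: rev_induct)
  case Nil
  then show ?case by (simp add: staircase_def)
next
  case (snoc T G)
  show ?case
  proof (cases "G = []")
    case True
    then show ?thesis by (simp add: count_single_tile word_count_def component_def)
  next
    case False
    define S where "S = last G"
    have G: "staircase G" "adjacent S T" and f: "sign_function f G" "tile_signed f T" "tile_signed f S"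
      using snoc.prems False by (auto simp: staircase_append S_def sign_function_iff)
    obtain a where a: "a \<in> {North, East}" "T = S + shift a" using G(2) by fastforce
    define c where "c = f (side_edge a S)"
    have c: "c \<in> {1, -1}" unfolding c_def using f tile_signedD by blast
    have "shared_edge S T = side_edge a S" using a by (auto simp: shared_edge_def)
    then have w: "signs f (G @ [T]) = signs f G @ [c]" using False by (simp add: signs_append S_def c_def)
    have partner: "f (side_edge (partner a) T) = c" "f (side_edge a T) = - c"
      using a tile_signedD[OF f(2)] side_edge_adjacent[of S] unfolding c_def by auto
    have IH: "int (card {M \<in> Match (graph_of G). side_edge a S \<in> M}) = component c (word_vec (signs f G))"
      "count (graph_of G) = word_count (signs f G)"
      using snoc.IH[OF G(1) f(1), folded S_def] a(1) unfolding c_def by blast+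
    note step = count_snoc[OF G(1) a(1), folded S_def, folded a(2)]
    have 1: "int (card {M \<in> Match (graph_of (G @ [T])). side_edge a T \<in> M})
        = component (- c) (word_vec (signs f G @ [c]))"
      using IH c by (auto simp: step component_def sign_step_def word_count_def)
    have 2: "int (card {M \<in> Match (graph_of (G @ [T])). side_edge (partner a) T \<in> M})
        = component c (word_vec (signs f G @ [c]))"
      using IH c by (auto simp: step component_def sign_step_def word_count_def)
    have 3: "count (graph_of (G @ [T])) = word_count (signs f G @ [c])"
      using 1 2 c unfolding step by (auto simp: component_def word_count_def)
    show ?thesis using 1 2 3 a(1) partner unfolding w by auto
  qed
qed

lemmas count_graph_of = count_graph_of_aux[THEN conjunct2]

lemma side_edge_nonempty [simp]: "side_edge a T \<noteq> {}"
  by (cases T; cases a) auto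

section \<open>Sign functions of the lattice\<close>

lemma tile_signed_agree:
  assumes "tile_signed f T" "tile_signed g T" "f (side_edge a T) = g (side_edge a T)"
  shows "f (side_edge b T) = g (side_edge b T)"
  using assms by (cases a; cases b) (auto simp: tile_signed_def)

lemma tile_signed_adjacent:
  assumes "tile_signed f S" "tile_signed f T" "adjacent S T"
  shows "f (side_edge North T) = - f (side_edge North S)"
proof -
  have "T = S + (0, 1) \<Longrightarrow> side_edge South T = side_edge North S"
    "T = S + (1, 0) \<Longrightarrow> side_edge West T = side_edge East S" by simp_all
  then show ?thesis using assms tile_signedD[OF assms(1)] tile_signedD[OF assms(2)] by fastforce
qed

text \<open>
  A sign function is determined by one value, because consecutive tiles share an edge.
\<close>

lemma sign_functions_agree:
  assumes G: "staircase G" and f: "sign_function f G" and g: "sign_function g G"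
    and T: "T \<in> set G" "f (side_edge a T) = g (side_edge a T)" and S: "S \<in> set G"
  shows "f (side_edge b S) = g (side_edge b S)"
proof -
  let ?P = "\<lambda>i. f (side_edge North (G ! i)) = g (side_edge North (G ! i))"
  have fg: "tile_signed f (G ! i)" "tile_signed g (G ! i)" if "i < length G" for i
    using f g that by (auto simp: sign_function_iff)
  have P: "?P i = ?P 0" if "i < length G" for i
    using that
  proof (induction i)
    case (Suc i)
    then show ?case
      using tile_signed_adjacent[OF fg(1) fg(1) staircase_nth[OF G]]
        tile_signed_adjacent[OF fg(2) fg(2) staircase_nth[OF G]] by simp
  qed simp
  obtain i j where ij: "i < length G" "T = G ! i" "j < length G" "S = G ! j"
    using T(1) S by (metis in_set_conv_nth)
  have "?P i" using tile_signed_agree[OF fg[OF ij(1)], of a North] T(2) ij by simp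
  then have "?P j" using P ij by simp
  then show ?thesis using tile_signed_agree[OF fg[OF ij(3)], of North b] ij by simp
qed

text \<open>
  A sign function on the whole lattice, a checkerboard pattern. Every sign function of a snake
  graph is a restriction of it or of its negative; this makes it possible to combine sign
  functions of two pieces into one on the glued graph.
\<close>

definition lattice_sign :: "edge \<Rightarrow> int" where
  "lattice_sign e =
     (if (\<exists>x y. e = {(x, y), (x + 1, y)} \<and> odd (x + y)) \<or>
         (\<exists>x y. e = {(x, y), (x, y + 1)} \<and> even (x + y)) then 1 else - 1)"

lemma lattice_sign_horizontal: "lattice_sign {(x, y), (x + 1, y)} = (if odd (x + y) then 1 else - 1)"
  by (auto simp: lattice_sign_def doubleton_eq_iff)

lemma lattice_sign_vertical: "lattice_sign {(x, y), (x, y + 1)} = (if even (x + y) then 1 else - 1)"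
  by (auto simp: lattice_sign_def doubleton_eq_iff)

lemma tile_signed_lattice_sign: "tile_signed lattice_sign T"
proof (cases T)
  case (Pair x y)
  show ?thesis
    unfolding tile_signed_def Pair side_edge.simps
    lattice_sign_horizontal lattice_sign_vertical by auto
qed

lemma lattice_sign_function:
  assumes "c \<in> {1, -1}"
  obtains h where "\<And>T. tile_signed h T" "h (side_edge a S) = c"
proof -
  define h where "h e = lattice_sign (side_edge a S) * c * lattice_sign e" for e
  have l: "lattice_sign (side_edge a S) \<in> {1, -1}" by (rule tile_signedD(1)[OF tile_signed_lattice_sign])
  have "tile_signed h T" for T
    using tile_signed_lattice_sign[of T] l assms unfolding tile_signed_def h_def by auto
  moreover have "h (side_edge a S) = c" using l by (auto simp: h_def)
  ultimately show thesis by (rule that)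
qed

section \<open>Motions\<close>

lemma move_side_edge:
  "move m ` side_edge a T = side_edge (if fst m then partner a else a) (move m T)"
  by (cases T; cases "snd m"; cases a) (auto simp: move_def insert_commute algebra_simps)

lemma tile_signed_move: "tile_signed (\<lambda>e. f (move m ` e)) T \<longleftrightarrow> tile_signed f (move m T)"
  unfolding tile_signed_def move_side_edge by (cases "fst m") auto

lemma move_adjacent: "adjacent S T \<Longrightarrow> adjacent (move m S) (move m T)"
  by (cases S) (auto simp: move_def algebra_simps)

lemma shared_edge_simps [simp]:
  "shared_edge S (S + (0, 1)) = side_edge North S" "shared_edge S (S + (1, 0)) = side_edge East S"
  by (simp_all add: shared_edge_def)

lemma move_plus:
  "move m (S + (0, 1)) = move m S + (if fst m then (1, 0) else (0, 1))"
  "move m (S + (1, 0)) = move m S + (if fst m then (0, 1) else (1, 0))"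
  by (cases S; simp add: move_def)+

lemma shared_edge_move:
  "adjacent S T \<Longrightarrow> shared_edge (move m S) (move m T) = move m ` shared_edge S T"
  by (elim disjE) (simp_all add: move_side_edge move_plus)

lemma staircase_move:
  assumes "staircase G"
  shows "staircase (map (move m) G)"
proof -
  have "successively adjacent G" using assms by (simp add: staircase_def)
  then have "successively (\<lambda>S T. adjacent (move m S) (move m T)) G"
    by (rule successively_mono) (rule move_adjacent)
  then show ?thesis using assms unfolding staircase_def successively_map by simp
qed

lemma signs_move:
  "successively adjacent G \<Longrightarrow> signs f (map (move m) G) = signs (\<lambda>e. f (move m ` e)) G"
  by (induction f G rule: signs.induct) (simp_all add: shared_edge_move)

lemma sign_function_move:
  "sign_function f (map (move m) G) \<longleftrightarrow> sign_function (\<lambda>e. f (move m ` e)) G"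
  by (simp add: sign_function_iff tile_signed_move)

lemma translate_eq_move: "translate v G = map (move (False, v)) G"
  by (simp add: translate_def move_def)

section \<open>Gluing\<close>

lemma opposite_side_shift: "a \<in> {North, East} \<Longrightarrow> side_edge (opposite_side a) (S + shift a) = side_edge a S"
  by auto

text \<open>
  Agreement of the two sign functions on the gluing edge makes them restrictions of one sign
  function on the glued graph, up to the translation that is part of the gluing.
\<close>

lemma count_glue:
  assumes A: "staircase A" "sign_function f A" and B: "staircase B" "sign_function g B"
    and a: "a \<in> {North, East}"
    and fg: "f (side_edge a (last A)) = g (side_edge (opposite_side a) (hd B))"
  shows "count (graph_of (glue A a B (opposite_side a))) =
      word_count (signs f A @ f (side_edge a (last A)) # signs g B)"
proof -
  define v where "v = lower_left_end a (last A) - lower_left_end (opposite_side a) (hd B)"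
  define B' where "B' = map (move (False, v)) B"
  have glue: "glue A a B (opposite_side a) = A @ B'"
    by (simp add: glue_def B'_def v_def translate_eq_move)
  have ne: "A \<noteq> []" "B \<noteq> []" using A B by (auto simp: staircase_def)
  have hd: "hd B' = move (False, v) (hd B)" "move (False, v) (hd B) = last A + shift a"
    using ne a by (cases "last A"; cases "hd B"; auto simp: B'_def v_def hd_map move_def)+
  have adj: "adjacent (last A) (hd B')" using a hd by auto
  have B': "staircase B'" unfolding B'_def by (rule staircase_move[OF B(1)])
  have G: "staircase (glue A a B (opposite_side a))"
    unfolding glue staircase_append using A B' adj by (simp add: staircase_def)
  have lastA: "last A \<in> set A" using ne by simp
  have "f (side_edge a (last A)) \<in> {1, -1}"
    using A(2) lastA tile_signedD(1) by (auto simp: sign_function_iff)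
  then obtain h where h: "\<And>T. tile_signed h T" "h (side_edge a (last A)) = f (side_edge a (last A))"
    using lattice_sign_function[of "f (side_edge a (last A))" a "last A"] by blast
  have hA: "signs h A = signs f A"
    by (rule signs_cong, rule sign_functions_agree[where f = h and g = f and a
        = a, OF A(1) _ A(2) lastA h(2)])
      (simp_all add: sign_function_iff h)
  have "signs h B' = signs (\<lambda>e. h (move (False, v) ` e)) B"
    unfolding B'_def using B(1) by (simp add: signs_move staircase_def)
  moreover have h': "sign_function (\<lambda>e. h (move (False, v) ` e)) B"
    by (simp add: sign_function_iff tile_signed_move[where f = h] h(1))
  have "signs (\<lambda>e. h (move (False, v) ` e)) B = signs g B"
  proof (rule signs_cong)
    fix T b assume "T \<in> set B"
    have "h (side_edge (opposite_side a) (hd B')) = g (side_edge (opposite_side a) (hd B))"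
      using hd fg h(2) opposite_side_shift[OF a] by simp
    then have "h (move (False, v) ` side_edge (opposite_side a) (hd B))
        = g (side_edge (opposite_side a) (hd B))"
      by (simp add: move_side_edge hd)
    then show "h (move (False, v) ` side_edge b T) = g (side_edge b T)"
      using sign_functions_agree[OF B(1) h' B(2), of "hd B" "opposite_side a" T b] ne \<open>T \<in> set B\<close>
      by simp
  qed
  ultimately have hB: "signs h B' = signs g B" by simp
  have "shared_edge (last A) (hd B') = side_edge a (last A)"
    using a hd by (auto simp: shared_edge_def)
  then have "signs h (A @ B') = signs f A @ f (side_edge a (last A)) # signs g B"
    using ne B' by (simp add: signs_append hA hB h(2) staircase_def)
  moreover have "sign_function h (A @ B')" by (simp add: sign_function_iff h)
  ultimately show "count (graph_of (glue A a B (opposite_side a))) =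
      word_count (signs f A @ f (side_edge a (last A)) # signs g B)"
    using count_graph_of[of "A @ B'" h] G glue by simp
qed

section \<open>Reversal\<close>

text \<open>
  The reflection of points that underlies \<open>rev_snake\<close>; it maps the lower left corner of a tile to
  the upper right corner of the image tile, so tiles need a separate map.
\<close>

definition reflect :: "point \<Rightarrow> point" where
  "reflect p = (- snd p, - fst p)"

definition reflect_tile :: "tile \<Rightarrow> tile" where
  "reflect_tile T = (- snd T - 1, - fst T - 1)"

lemma rev_snake_eq: "rev_snake G = rev (map reflect_tile G)"
  by (simp add: rev_snake_def reflect_tile_def case_prod_unfold)

lemma reflect_side_edge: "reflect ` side_edge a T = side_edge (rev_side a) (reflect_tile T)"
  by (cases T; cases a) (auto simp: reflect_def reflect_tile_def insert_commute)

lemma reflect_tile_reflect_tile [simp]: "reflect_tile (reflect_tile T) = T"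
  by (simp add: reflect_tile_def)

lemma reflect_adjacent: "adjacent S T \<Longrightarrow> adjacent (reflect_tile T) (reflect_tile S)"
  by (cases S) (auto simp: reflect_tile_def)

lemma shared_edge_reflect:
  "adjacent S T \<Longrightarrow> reflect ` shared_edge (reflect_tile T) (reflect_tile S) = shared_edge S T"
  by (cases S) (auto simp: shared_edge_def reflect_tile_def reflect_def)

lemma staircase_rev_snake:
  assumes "staircase G"
  shows "staircase (rev_snake G)"
proof -
  have "successively adjacent G" using assms by (simp add: staircase_def)
  then have "successively (\<lambda>S T. adjacent (reflect_tile T) (reflect_tile S)) G"
    by (rule successively_mono) (rule reflect_adjacent)
  then show ?thesis
    using assms unfolding staircase_def rev_snake_eq successively_rev successively_map by simp
qed

text \<open>
  The reflection exchanges north with west and east with south, so it preserves sign functions.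
\<close>

definition reversed_sign :: "(edge \<Rightarrow> int) \<Rightarrow> edge \<Rightarrow> int" where
  "reversed_sign f e = f (reflect ` e)"

lemma rev_side_rev_side [simp]: "rev_side (rev_side a) = a"
  by (cases a) auto

lemma reversed_sign_side: "reversed_sign f (side_edge a (reflect_tile T)) = f (side_edge (rev_side a) T)"
  by (simp add: reversed_sign_def reflect_side_edge)

lemma sign_function_rev_snake: "sign_function f G \<Longrightarrow> sign_function (reversed_sign f) (rev_snake G)"
  by (auto simp: sign_function_iff rev_snake_eq tile_signed_def reversed_sign_side)

lemma signs_rev_snake:
  "successively adjacent G \<Longrightarrow> signs (reversed_sign f) (rev_snake G) = rev (signs f G)"
proof (induction f G rule: signs.induct)
  case (1 f S T G)
  have "signs (reversed_sign f) (rev_snake (S # T # G)) =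
    signs (reversed_sign f) (rev_snake (T # G) @ [reflect_tile S])"
    by (simp add: rev_snake_eq)
  also have "\<dots> = signs (reversed_sign f) (rev_snake (T # G)) @
      [reversed_sign f (shared_edge (reflect_tile T) (reflect_tile S))]"
    by (subst signs_append) (simp_all add: rev_snake_eq)
  also have "reversed_sign f (shared_edge (reflect_tile T) (reflect_tile S)) = f (shared_edge S T)"
    using 1(2) by (simp add: reversed_sign_def shared_edge_reflect)
  finally show ?case using 1 by simp
qed (simp_all add: rev_snake_eq)

lemma last_rev_snake: "G \<noteq> [] \<Longrightarrow> last (rev_snake G) = reflect_tile (hd G)"
  and hd_rev_snake: "G \<noteq> [] \<Longrightarrow> hd (rev_snake G) = reflect_tile (last G)"
  by (simp_all add: rev_snake_eq last_rev hd_rev hd_map last_map)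

lemma sign_function_uminus: "sign_function f G \<Longrightarrow> sign_function (\<lambda>e. - f e) G"
  by (auto simp: sign_function_iff tile_signed_def)

lemma signs_uminus: "signs (\<lambda>e. - f e) G = map uminus (signs f G)"
  by (induction f G rule: signs.induct) auto

lemma sign_function_exists: obtains f where "sign_function f G"
  using lattice_sign_function[of 1] by (metis insertI1 sign_function_iff)

lemma count_rev_snake:
  assumes "staircase G"
  shows "count (graph_of (rev_snake G)) = count (graph_of G)"
proof -
  obtain f where f: "sign_function f G" by (rule sign_function_exists)
  have "count (graph_of (rev_snake G)) = word_count (rev (signs f G))"
    using count_graph_of[OF staircase_rev_snake sign_function_rev_snake, OF assms f] assms
    by (simp add: signs_rev_snake staircase_def)
  then show ?thesis using count_graph_of[OF assms f] sign_word_signs[OF f] by (simp add: word_count_rev)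
qed

section \<open>Initial and final pieces\<close>

lemma staircase_sub_snake:
  assumes "staircase G" "1 \<le> i" "i \<le> j" "j \<le> length G"
  shows "staircase (sub_snake G i j)"
  unfolding sub_snake_def using assms by (intro staircase_drop staircase_take) auto

lemma sign_function_sub_snake: "sign_function f G \<Longrightarrow> sign_function f (sub_snake G i j)"
  unfolding sign_function_iff sub_snake_def by (meson in_set_dropD in_set_takeD)

lemma signs_sub_snake: "signs f (sub_snake G i j) = drop (i - 1) (take (j - 1) (signs f G))"
  by (simp add: sub_snake_def signs_drop signs_take)

lemma hd_sub_snake:
  "1 \<le> i \<Longrightarrow> i \<le> j \<Longrightarrow> j \<le> length G \<Longrightarrow> hd (sub_snake G i j) = nth_tile G i"
  by (simp add: sub_snake_def nth_tile_def hd_drop_conv_nth)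

lemma last_sub_snake:
  "1 \<le> i \<Longrightarrow> i \<le> j \<Longrightarrow> j \<le> length G \<Longrightarrow> last (sub_snake G i j) = nth_tile G j"
  by (cases "G = []") (simp_all add: sub_snake_def nth_tile_def last_conv_nth min_def)

text \<open>
  The two candidate edges carry opposite signs, so that the description is proper; all that
  matters about the chosen edge is that it is not empty.
\<close>

lemma The_side_edge:
  fixes f :: "edge \<Rightarrow> int"
  assumes "f (side_edge a T) = - f (side_edge b T)" "f (side_edge a T) \<in> {1, -1}" "c \<in> {1, -1}"
  shows "(THE e. e \<in> {side_edge a T, side_edge b T} \<and> f e = c) \<noteq> {}"
proof -
  have "f (side_edge a T) \<noteq> f (side_edge b T)" using assms by auto
  moreover have "f (side_edge a T) = c \<or> f (side_edge b T) = c" using assms by auto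
  ultimately have "\<exists>!e. e \<in> {side_edge a T, side_edge b T} \<and> f e = c"
    by (elim disjE) (rule ex1I[of _ "side_edge a T"] ex1I[of _ "side_edge b T"]; force)+
  from theI'[OF this] show ?thesis by auto
qed

text \<open>
  The piece is cut off at the last interior edge of sign \<open>c\<close>, where the coordinate \<open>- c\<close> of the
  row vector was last replaced by a full count. The map \<open>R\<close> is the identity or the reversal.
\<close>

lemma
  assumes G: "staircase G" "sign_function f G" and m: "1 \<le> m" "m \<le> length G" and c: "c \<in> {1, -1}"
    and R: "\<And>A. staircase A \<Longrightarrow> count (graph_of (R A)) = count (graph_of A)"
  shows proper_initial_piece: "proper (initial_piece R G f m c)"
    and count_initial_piece: "count (initial_piece R G f m c)
        = component (- c) (word_vec (take (m - 1) (signs f G)))"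
proof -
  let ?w = "signs f G"
  define K where "K = {k. 1 \<le> k \<and> k < m \<and> f (interior_edge G k) = c}"
  have K: "k \<in> K \<longleftrightarrow> 1 \<le> k \<and> k < m \<and> ?w ! (k - 1) = c" for k
    using m nth_signs_interior[of k G f] by (auto simp: K_def)
  have "finite K" by (auto simp: K_def)
  have w: "sign_word ?w" by (rule sign_word_signs[OF G(2)])
  define H where "H = initial_piece R G f m c"
  have "proper H \<and> count H = component (- c) (word_vec (take (m - 1) ?w))"
  proof (cases "K = {}")
    case True
    define e where "e = (THE e. e \<in> {side_edge South (nth_tile G 1), side_edge West (nth_tile G 1)}
        \<and> f e = c)"
    have "nth_tile G 1 \<in> set G" using m by (cases G) (auto simp: nth_tile_def)
    then have "tile_signed f (nth_tile G 1)" using G(2) by (simp add: sign_function_iff)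
    then have "e \<noteq> {}" unfolding e_def using c
      by (intro The_side_edge) (auto simp: tile_signed_def)
    moreover have "H = single_edge e"
      unfolding H_def initial_piece_def Let_def K_def[symmetric] e_def using True by simp
    moreover have "c \<notin> set (take (m - 1) ?w)"
    proof
      assume "c \<in> set (take (m - 1) ?w)"
      then obtain i where "i < m - 1" "?w ! i = c" using m by (auto simp: in_set_conv_nth)
      then show False using True K[of "Suc i"] by auto
    qed
    then have "component (- c) (word_vec (take (m - 1) ?w)) = 1"
      using c w by (intro component_word_vec_notin) (auto dest: in_set_takeD)
    ultimately show ?thesis by (simp add: count_single_edge proper_single_edge)
  next
    case False
    define k where "k = Max K"
    have k: "k \<in> K" "\<And>j. j \<in> K \<Longrightarrow> j \<le> k"
      using False \<open>finite K\<close> by (simp_all add: k_def)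
    have "take (m - 1) ?w = take (k - 1) ?w @ c # drop k (take (m - 1) ?w)"
    proof -
      have k': "1 \<le> k" "k < m" "?w ! (k - 1) = c" using k(1) K[of k] by auto
      then have "k - 1 < length (take (m - 1) ?w)" "take (m - 1) ?w ! (k - 1) = c" using m by auto
      then show ?thesis
        using id_take_nth_drop[of "k - 1" "take (m - 1) ?w"] k' by (simp add: min_absorb1)
    qed
    moreover have "c \<notin> set (drop k (take (m - 1) ?w))"
    proof
      assume "c \<in> set (drop k (take (m - 1) ?w))"
      then obtain i where "i < length (drop k (take (m - 1) ?w))" "drop k (take (m - 1) ?w) ! i = c"
        by (metis in_set_conv_nth)
      moreover from this have "k \<le> length (take (m - 1) ?w)" unfolding length_drop by linarith
      ultimately have "k + i < m - 1" "?w ! (k + i) = c" by simp_all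
      then show False using k(2)[of "Suc (k + i)"] K[of "Suc (k + i)"] by auto
    qed
    ultimately have "component (- c) (word_vec (take (m - 1) ?w)) = word_count (take (k - 1) ?w)"
      using component_word_vec_split[of "drop k (take (m - 1) ?w)" "- c" "take (k - 1) ?w"] w c
      by (auto dest!: in_set_dropD in_set_takeD)
    moreover have sub: "staircase (sub_snake G 1 k)"
      using k(1) K m by (intro staircase_sub_snake[OF G(1)]) auto
    moreover have "H = graph_of (R (sub_snake G 1 k))"
      unfolding H_def initial_piece_def Let_def K_def[symmetric] k_def using False by simp
    ultimately show ?thesis
      using R count_graph_of[OF sub sign_function_sub_snake[OF G(2)]]
      by (simp add: signs_sub_snake proper_graph_of)
  qed
  then show "proper (initial_piece R G f m c)"
    "count (initial_piece R G f m c) = component (- c) (word_vec (take (m - 1) ?w))"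
    by (simp_all add: H_def)
qed

text \<open>
  The mirror image of the statement on initial pieces: in the dual word the first letter \<open>c\<close>
  becomes the last letter \<open>- c\<close>.
\<close>

lemma
  assumes G: "staircase G" "sign_function f G" and m: "1 \<le> m" "m \<le> length G" and c: "c \<in> {1, -1}"
    and R: "\<And>A. staircase A \<Longrightarrow> count (graph_of (R A)) = count (graph_of A)"
  shows proper_final_piece: "proper (final_piece R G f m c)"
    and count_final_piece: "count (final_piece R G f m c)
        = component c (word_vec (dual_word (drop (m - 1) (signs f G))))"
proof -
  let ?w = "signs f G" and ?d = "length G"
  define K where "K = {k. m < k \<and> k \<le> ?d \<and> f (interior_edge G (k - 1)) = c}"
  have K: "k \<in> K \<longleftrightarrow> m < k \<and> k \<le> ?d \<and> ?w ! (k - 2) = c" for k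
    using m nth_signs_interior[of "k - 1" G f] by (auto simp: K_def numeral_2_eq_2)
  have "finite K" by (auto simp: K_def)
  have w: "sign_word ?w" by (rule sign_word_signs[OF G(2)])
  define H where "H = final_piece R G f m c"
  have "proper H \<and> count H = component c (word_vec (dual_word (drop (m - 1) ?w)))"
  proof (cases "K = {}")
    case True
    define e where "e = (THE e. e \<in> {side_edge North (nth_tile G ?d), side_edge East (nth_tile G ?d)}
        \<and> f e = c)"
    have "nth_tile G ?d \<in> set G" using m by (simp add: nth_tile_def)
    then have "tile_signed f (nth_tile G ?d)" using G(2) by (simp add: sign_function_iff)
    then have "e \<noteq> {}" unfolding e_def using c
      by (intro The_side_edge) (auto simp: tile_signed_def)
    moreover have "H = single_edge e"
      unfolding H_def final_piece_def Let_def K_def[symmetric] e_def using True by simp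
    moreover have "c \<notin> set (drop (m - 1) ?w)"
    proof
      assume "c \<in> set (drop (m - 1) ?w)"
      then obtain i where "i < length (drop (m - 1) ?w)" "drop (m - 1) ?w ! i = c"
        by (metis in_set_conv_nth)
      then have "m - 1 + i < ?d - 1" "?w ! (m - 1 + i) = c" using m by auto
      then show False using True K[of "m + i + 1"] m by auto
    qed
    then have "component c (word_vec (dual_word (drop (m - 1) ?w))) = 1"
      using c w by (intro component_word_vec_notin sign_word_dual_word) (auto simp: dual_word_def dest:
          in_set_dropD)
    ultimately show ?thesis by (simp add: count_single_edge proper_single_edge)
  next
    case False
    define k where "k = Min K"
    have k: "k \<in> K" "\<And>j. j \<in> K \<Longrightarrow> k \<le> j"
      using False \<open>finite K\<close> by (simp_all add: k_def)
    define u where "u = take (k - 1 - m) (drop (m - 1) ?w)"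
    have split: "drop (m - 1) ?w = u @ c # drop (k - 1) ?w"
    proof -
      have "k - 1 - m < length (drop (m - 1) ?w)" "drop (m - 1) ?w ! (k - 1 - m) = c"
        using k(1) m K[of k] by (auto simp: numeral_2_eq_2)
      then show ?thesis
        using id_take_nth_drop[of "k - 1 - m" "drop (m - 1) ?w"] k(1) K[of k] m by (simp add: u_def)
    qed
    have c_u: "c \<notin> set u"
    proof
      assume "c \<in> set u"
      then obtain i where "i < k - 1 - m" "?w ! (m - 1 + i) = c"
        unfolding u_def using k(1) m K[of k] by (auto simp: in_set_conv_nth)
      then have "m + i + 1 \<in> K" using k(1) K[of k] K[of "m + i + 1"] m by (auto simp: numeral_2_eq_2)
      then show False using k(2)[of "m + i + 1"] \<open>i < k - 1 - m\<close> by simp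
    qed
    have "sign_word u" "sign_word (drop (k - 1) ?w)"
      unfolding u_def using w by (auto dest!: in_set_dropD in_set_takeD)
    moreover have "- c \<notin> set (dual_word u)" using c_u by (auto simp: dual_word_def)
    ultimately have "component c (word_vec (dual_word (drop (m - 1) ?w)))
        = word_count (dual_word (drop (k - 1) ?w))"
      using component_word_vec_split[of "dual_word u" c "dual_word (drop (k - 1) ?w)"] c unfolding split
          by simp
    then have "component c (word_vec (dual_word (drop (m - 1) ?w))) = word_count (drop (k - 1) ?w)"
      using \<open>sign_word (drop (k - 1) ?w)\<close> by (simp add: word_count_dual_word)
    moreover have sub: "staircase (sub_snake G k ?d)"
      using k(1) K m by (intro staircase_sub_snake[OF G(1)]) auto
    moreover have "H = graph_of (R (sub_snake G k ?d))"
      unfolding H_def final_piece_def Let_def K_def[symmetric] k_def using False by simp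
    ultimately show ?thesis
      using R count_graph_of[OF sub sign_function_sub_snake[OF G(2)]]
      by (simp add: signs_sub_snake proper_graph_of)
  qed
  then show "proper (final_piece R G f m c)"
    "count (final_piece R G f m c) = component c (word_vec (dual_word (drop (m - 1) ?w)))"
    by (simp_all add: H_def)
qed

section \<open>Resolution of a crossing\<close>

lemma adjacent_nth_tile:
  assumes "staircase G" "1 \<le> i" "i < length G"
  shows "adjacent (nth_tile G i) (nth_tile G (i + 1))"
  using staircase_nth[OF assms(1), of "i - 1"] assms by (simp add: nth_tile_def)

lemma nth_tile_in_set: "1 \<le> i \<Longrightarrow> i \<le> length G \<Longrightarrow> nth_tile G i \<in> set G"
  by (simp add: nth_tile_def)

lemma step_cases:
  assumes "staircase G" "1 \<le> i" "i < length G"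
  obtains (north) "nth_tile G (i + 1) = nth_tile G i + (0, 1)" "next_is_north G i" "\<not> next_is_east G i"
      "interior_edge G i = side_edge North (nth_tile G i)"
      "interior_edge G i = side_edge South (nth_tile G (i + 1))"
  | (east) "nth_tile G (i + 1) = nth_tile G i + (1, 0)" "next_is_east G i" "\<not> next_is_north G i"
      "interior_edge G i = side_edge East (nth_tile G i)"
      "interior_edge G i = side_edge West (nth_tile G (i + 1))"
proof (cases "nth_tile G (i + 1) = nth_tile G i + (0, 1)")
  case True
  then show ?thesis
    by (intro north) (simp_all add: next_is_north_iff next_is_east_iff interior_edge_eq)
next
  case False
  then have "nth_tile G (i + 1) = nth_tile G i + (1, 0)" using adjacent_nth_tile[OF assms] by blast
  then show ?thesis
    by (intro east) (simp_all add: next_is_north_iff next_is_east_iff interior_edge_eq)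
qed

lemma
  assumes "staircase G" "sign_function f G" "1 \<le> i" "i < length G"
  shows next_tile_sign: "f (side_edge North (nth_tile G (i + 1))) = - f (side_edge North (nth_tile G i))"
    and interior_edge_sign_eq: "f (interior_edge G i) =
      (if next_is_north G i then 1 else - 1) * f (side_edge North (nth_tile G i))"
    and next_is_east_iff_not_north: "next_is_east G i \<longleftrightarrow> \<not> next_is_north G i"
    and interior_edge_sign: "f (interior_edge G i) \<in> {1, -1}"
proof -
  have signed: "tile_signed f (nth_tile G i)" "tile_signed f (nth_tile G (i + 1))"
    using assms nth_tile_in_set[of i G] nth_tile_in_set[of "i + 1" G] by (simp_all add: sign_function_iff)
  show "f (side_edge North (nth_tile G (i + 1))) = - f (side_edge North (nth_tile G i))"
    by (rule tile_signed_adjacent[OF signed adjacent_nth_tile[OF assms(1,3,4)]])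
  show "f (interior_edge G i) = (if next_is_north G i then 1 else - 1) * f (side_edge North (nth_tile G i))"
    by (cases rule: step_cases[OF assms(1,3,4)]) (simp_all only: tile_signedD(2-)[OF signed(1)], simp_all)
  show "next_is_east G i \<longleftrightarrow> \<not> next_is_north G i"
    by (cases rule: step_cases[OF assms(1,3,4)]) simp_all
  have "f (interior_edge G i) = f (side_edge North (nth_tile G i)) \<or>
    f (interior_edge G i) = f (side_edge East (nth_tile G i))"
    by (cases rule: step_cases[OF assms(1,3,4)]) simp_all
  then show "f (interior_edge G i) \<in> {1, -1}"
    using tile_signedD(1)[OF signed(1), of North] tile_signedD(1)[OF signed(1), of East] by metis
qed

lemma take_signs_snoc:
  "1 \<le> i \<Longrightarrow> i < length G \<Longrightarrow> take i (signs f G) = take (i - 1) (signs f G) @ [f (interior_edge G i)]"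
  using take_Suc_conv_app_nth[of "i - 1" "signs f G"] by (simp add: nth_signs_interior)

lemma drop_signs_Cons:
  "1 \<le> i \<Longrightarrow> i < length G \<Longrightarrow> drop (i - 1) (signs f G) = f (interior_edge G i) # drop i (signs f G)"
  using Cons_nth_drop_Suc[of "i - 1" "signs f G"] by (simp add: nth_signs_interior)

text \<open>
  If \<open>G2\<close> ends with the overlap, there is nothing to glue. Otherwise superimposing the tiles
  \<open>G\<^sub>t\<close> and \<open>G'\<^sub>t\<^sub>'\<close> is the same as gluing along the edge by which \<open>G2\<close> leaves the overlap.
\<close>

lemma count_res3:
  assumes G1: "staircase G1" "sign_function f1 G1" and G2: "staircase G2" "sign_function f2 G2"
    and t: "1 \<le> t" "t \<le> length G1" "1 \<le> t'" "t' \<le> length G2"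
    and agree: "f1 (side_edge North (nth_tile G1 t)) = f2 (side_edge North (nth_tile G2 t'))"
  shows "count (res3 G1 G2 t t') = word_count (take (t - 1) (signs f1 G1) @ drop (t' - 1) (signs f2 G2))"
proof (cases "t' = length G2")
  case True
  then have "res3 G1 G2 t t' = graph_of (sub_snake G1 1 t)"
    by (simp add: res3_def sub_snake_def translate_def)
  then show ?thesis
    using count_graph_of[OF staircase_sub_snake sign_function_sub_snake, OF G1(1) _ _ _ G1(2), of 1 t] t
        True
    by (simp add: signs_sub_snake)
next
  case False
  then have t': "t' < length G2" using t by simp
  define A B where "A = sub_snake G1 1 t" and "B = sub_snake G2 (t' + 1) (length G2)"
  have A: "staircase A" "sign_function f1 A" "last A = nth_tile G1 t" "signs f1 A
      = take (t - 1) (signs f1 G1)"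
    unfolding A_def using t G1 by (simp_all add: staircase_sub_snake sign_function_sub_snake
        last_sub_snake signs_sub_snake)
  have B: "staircase B" "sign_function f2 B" "hd B = nth_tile G2 (t' + 1)" "signs f2 B
      = drop t' (signs f2 G2)"
    unfolding B_def using t' G2 by (simp_all add: staircase_sub_snake sign_function_sub_snake
        hd_sub_snake signs_sub_snake)
  obtain a where a: "a \<in> {North, East}" "nth_tile G2 (t' + 1) = nth_tile G2 t' + shift a"
      "interior_edge G2 t' = side_edge a (nth_tile G2 t')"
    by (cases rule: step_cases[OF G2(1) t(3) t']) (metis insertI1 insertI2 shift.simps)+
  have signed: "tile_signed f1 (nth_tile G1 t)" "tile_signed f2 (nth_tile G2 t')"
    using G1 G2 t t' by (simp_all add: sign_function_iff nth_tile_in_set)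
  have f12: "f1 (side_edge a (nth_tile G1 t)) = f2 (interior_edge G2 t')"
    using a agree tile_signedD[OF signed(1)] tile_signedD[OF signed(2)] by auto
  have "lower_left_end a (last A) - lower_left_end (opposite_side a) (hd B)
      = nth_tile G1 t - nth_tile G2 t'"
    unfolding A(3) B(3) a(2) using a(1) by (cases "nth_tile G1 t"; cases "nth_tile G2 t'"; auto)
  then have "res3 G1 G2 t t' = graph_of (glue A a B (opposite_side a))"
    by (simp add: res3_def glue_def A_def B_def)
  moreover have "f1 (side_edge a (last A)) = f2 (side_edge (opposite_side a) (hd B))"
    unfolding A(3) B(3) a(2) opposite_side_shift[OF a(1)] by (simp add: f12 a(3))
  ultimately show ?thesis
    using count_glue[OF A(1,2) B(1,2) a(1)] drop_signs_Cons[OF t(3) t', of f2]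
    by (simp add: A B f12)
qed

lemma res4_eq_res3: "res4 G1 G2 t t' = res3 G2 G1 t' t"
  by (simp add: res3_def res4_def)

text \<open>
  The orientation of the glued pieces of \<open>G5\<close>, \<open>G6\<close> and of a grafting requires
  the negative of the sign function on the reversed graph, whose word is the dual word.
\<close>

lemma reverse_negated_sign:
  assumes "staircase G" "sign_function f G"
  defines "g \<equiv> \<lambda>e. - reversed_sign f e"
  shows "sign_function g (rev_snake G)" "signs g (rev_snake G) = dual_word (signs f G)"
    "g (side_edge a (hd (rev_snake G))) = - f (side_edge (rev_side a) (last G))"
    "g (side_edge a (last (rev_snake G))) = - f (side_edge (rev_side a) (hd G))"
  using assms
  by (simp_all add: sign_function_uminus sign_function_rev_snake signs_uminus signs_rev_snake
      hd_rev_snake last_rev_snake reversed_sign_side staircase_def dual_word_def)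

text \<open>
  The sign \<open>c\<close> is that with which \<open>G1\<close> enters the overlap, and \<open>G2\<close> enters with \<open>- c\<close>; if
  only one of the graphs extends beyond the overlap, \<open>c\<close> is defined by that one.
\<close>

lemma
  assumes G1: "staircase G1" "sign_function f1 G1" and G2: "staircase G2" "sign_function f2 G2"
    and s: "1 \<le> s" "s \<le> length G1" "1 \<le> s'" "s' \<le> length G2" "s \<noteq> 1 \<or> s' \<noteq> 1"
    and agree: "f1 (side_edge North (nth_tile G1 s)) = f2 (side_edge North (nth_tile G2 s'))"
    and c: "c \<in> {1, -1}" "1 < s \<Longrightarrow> f1 (interior_edge G1 (s - 1)) = c"
      "1 < s' \<Longrightarrow> f2 (interior_edge G2 (s' - 1)) = - c"
  shows proper_res5: "proper (res5 G1 G2 s s' f1 f2)"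
    and wedge_res5: "wedge (word_vec (take (s - 1) (signs f1 G1))) (word_vec (take (s' - 1) (signs f2
        G2))) =
      - c * count (res5 G1 G2 s s' f1 f2)"
proof -
  let ?w1 = "signs f1 G1" and ?w2 = "signs f2 G2" and ?R = "res5 G1 G2 s s' f1 f2"
  have w: "sign_word ?w1" "sign_word ?w2" using G1 G2 sign_word_signs by auto
  consider (both) "1 < s" "1 < s'" | (first) "1 < s" "s' = 1" | (second) "s = 1" "1 < s'"
    using s by linarith
  then have "proper ?R \<and> wedge (word_vec (take (s - 1) ?w1)) (word_vec (take (s' - 1) ?w2)) = - c
      * count ?R"
  proof cases
    case both
    define A A' where "A = sub_snake G1 1 (s - 1)" and "A' = sub_snake G2 1 (s' - 1)"
    have A: "staircase A" "sign_function f1 A" "last A = nth_tile G1 (s - 1)" "signs f1 A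
        = take (s - 2) ?w1"
      unfolding A_def using both s G1
      by (simp_all add: staircase_sub_snake sign_function_sub_snake last_sub_snake signs_sub_snake
          numeral_2_eq_2)
    have A': "staircase A'" "sign_function f2 A'" "last A' = nth_tile G2 (s' - 1)" "signs f2 A'
        = take (s' - 2) ?w2"
      unfolding A'_def using both s G2
      by (simp_all add: staircase_sub_snake sign_function_sub_snake last_sub_snake signs_sub_snake
          numeral_2_eq_2)
    note B = reverse_negated_sign[OF A'(1,2)]
    have signed: "tile_signed f1 (nth_tile G1 (s - 1))" "tile_signed f2 (nth_tile G2 (s' - 1))"
      using G1 G2 s both by (auto simp: sign_function_iff nth_tile_in_set)
    note sides = tile_signedD(2-)[OF signed(1)] tile_signedD(2-)[OF signed(2)]
    have i: "1 \<le> s - 1" "s - 1 < length G1" "1 \<le> s' - 1" "s' - 1 < length G2"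
      "s - 1 + 1 = s" "s' - 1 + 1 = s'" using s both by auto
    \<comment> \<open>the one of the north and east sides of \<open>G\<^sub>s\<^sub>-\<^sub>1\<close> that is not the interior edge: sign \<open>- c\<close>\<close>
    define a where "a = (if next_is_east G1 (s - 1) then North else East)"
    have "f1 (side_edge a (nth_tile G1 (s - 1))) = - c \<and>
       f2 (side_edge (rev_side (opposite_side a)) (nth_tile G2 (s' - 1))) = c"
      using c(2)[OF both(1)] agree next_tile_sign[OF G1 i(1,2)] next_tile_sign[OF G2 i(3,4)]
        interior_edge_sign_eq[OF G1 i(1,2)] next_is_east_iff_not_north[OF G1 i(1,2)] sides
      unfolding i(5,6) a_def by (cases "next_is_north G1 (s - 1)") simp_all
    then have c': "f1 (side_edge a (last A)) = - c"
      "f2 (side_edge (rev_side (opposite_side a)) (last A')) = c" by (simp_all add: A A')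
    have "a \<in> {North, East}" by (simp add: a_def)
    have R: "?R = graph_of (glue A a (rev_snake A') (opposite_side a))"
      using both by (simp add: res5_def Let_def A_def A'_def a_def)
    have "count ?R = word_count (take (s - 2) ?w1 @ [- c] @ dual_word (take (s' - 2) ?w2))"
      using count_glue[OF A(1,2) staircase_rev_snake[OF A'(1)] B(1) \<open>a \<in> {North, East}\<close>]
      by (simp add: R B c' A(4) A'(4))
    moreover have "take (s - 1) ?w1 = take (s - 2) ?w1 @ [c]" "take (s' - 1) ?w2
        = take (s' - 2) ?w2 @ [- c]"
      using take_signs_snoc[OF i(1,2), of f1] take_signs_snoc[OF i(3,4), of f2] c both
      by (simp_all add: numeral_2_eq_2)
    ultimately show ?thesis
      using wedge_word_vec_snoc[of "take (s - 2) ?w1" "take (s' - 2) ?w2" c] w c(1)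
      by (auto simp: R proper_graph_of dest: in_set_takeD)
  next
    case first
    have R: "?R = initial_piece (\<lambda>A. A) G1 f1 (s - 1) c"
      using first c by (simp add: res5_def)
    have i: "1 \<le> s - 1" "s - 1 < length G1" using s first by auto
    show ?thesis
      using count_initial_piece[OF G1 i(1) less_imp_le[OF i(2)] c(1), of "\<lambda>A. A"]
        proper_initial_piece[OF G1 i(1) less_imp_le[OF i(2)] c(1), of "\<lambda>A. A"]
        take_signs_snoc[OF i, of f1] wedge_word_vec_Nil[OF c(1)] c first
      unfolding R by simp
  next
    case second
    have R: "?R = initial_piece rev_snake G2 f2 (s' - 1) (- c)"
      using second c by (simp add: res5_def)
    have i: "1 \<le> s' - 1" "s' - 1 < length G2" using s second by auto
    have "- c \<in> {1, -1}" using c by auto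
    then show ?thesis
      using count_initial_piece[OF G2 i(1) less_imp_le[OF i(2)], of "- c" rev_snake]
        proper_initial_piece[OF G2 i(1) less_imp_le[OF i(2)], of "- c" rev_snake]
        take_signs_snoc[OF i, of f2] wedge_word_vec_Nil[of "- c"] c second
        wedge_swap[of "(1, 1)"] count_rev_snake
      unfolding R by simp
  qed
  then show "proper ?R" "wedge (word_vec (take (s - 1) ?w1)) (word_vec (take (s' - 1) ?w2)) = - c
      * count ?R"
    by simp_all
qed

text \<open>
  The counterpart of the previous lemma at the other end. Passing to dual words changes the signs
  of the letters, whence the different sign in front of \<open>c\<close>.
\<close>

lemma
  assumes G1: "staircase G1" "sign_function f1 G1" and G2: "staircase G2" "sign_function f2 G2"
    and t: "1 \<le> t" "t \<le> length G1" "1 \<le> t'" "t' \<le> length G2" "t \<noteq> length G1 \<or> t' \<noteq> length G2"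
    and agree: "f1 (side_edge North (nth_tile G1 t)) = f2 (side_edge North (nth_tile G2 t'))"
    and c: "c \<in> {1, -1}" "t < length G1 \<Longrightarrow> f1 (interior_edge G1 t) = c"
      "t' < length G2 \<Longrightarrow> f2 (interior_edge G2 t') = - c"
  shows proper_res6: "proper (res6 G1 G2 t t' f1 f2)"
    and wedge_res6: "wedge (word_vec (dual_word (drop (t - 1) (signs f1 G1)))) (word_vec (dual_word
        (drop (t' - 1) (signs f2 G2)))) =
      c * count (res6 G1 G2 t t' f1 f2)"
proof -
  let ?w1 = "signs f1 G1" and ?w2 = "signs f2 G2" and ?R = "res6 G1 G2 t t' f1 f2"
  have w: "sign_word ?w1" "sign_word ?w2" using G1 G2 sign_word_signs by auto
  consider (both) "t < length G1" "t' < length G2" | (second) "t = length G1" "t' < length G2"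
    | (first) "t < length G1" "t' = length G2"
    using t by linarith
  then have "proper ?R \<and>
    wedge (word_vec (dual_word (drop (t - 1) ?w1))) (word_vec (dual_word (drop (t' - 1) ?w2))) = c
        * count ?R"
  proof cases
    case both
    define B A' where "B = sub_snake G1 (t + 1) (length G1)" and "A' = sub_snake G2 (t' + 1) (length G2)"
    have B: "staircase B" "sign_function f1 B" "hd B = nth_tile G1 (t + 1)" "signs f1 B = drop t ?w1"
      unfolding B_def using both t G1
      by (simp_all add: staircase_sub_snake sign_function_sub_snake hd_sub_snake signs_sub_snake)
    have A': "staircase A'" "sign_function f2 A'" "hd A' = nth_tile G2 (t' + 1)" "signs f2 A' = drop t' ?w2"
      unfolding A'_def using both t G2
      by (simp_all add: staircase_sub_snake sign_function_sub_snake hd_sub_snake signs_sub_snake)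
    note A = reverse_negated_sign[OF A'(1,2)]
    have signed: "tile_signed f1 (nth_tile G1 (t + 1))" "tile_signed f2 (nth_tile G2 (t' + 1))"
      using G1 G2 t both by (auto simp: sign_function_iff nth_tile_in_set)
    note sides = tile_signedD(2-)[OF signed(1)] tile_signedD(2-)[OF signed(2)]
    \<comment> \<open>\<open>opposite_side a\<close> is the south or west side of \<open>G\<^sub>t\<^sub>+\<^sub>1\<close> that is not the interior edge\<close>
    define a where "a = (if next_is_north G1 t then East else North)"
    have "f1 (side_edge (opposite_side a) (nth_tile G1 (t + 1))) = - c \<and>
       f2 (side_edge (rev_side a) (nth_tile G2 (t' + 1))) = c"
      using c(2)[OF both(1)] agree next_tile_sign[OF G1 t(1) both(1)] next_tile_sign[OF G2 t(3) both(2)]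
        interior_edge_sign_eq[OF G1 t(1) both(1)] sides
      unfolding a_def by (cases "next_is_north G1 t") simp_all
    then have c': "f1 (side_edge (opposite_side a) (hd B)) = - c"
      "f2 (side_edge (rev_side a) (hd A')) = c" by (simp_all add: B A')
    have "a \<in> {North, East}" by (simp add: a_def)
    have R: "?R = graph_of (glue (rev_snake A') a B (opposite_side a))"
      using both by (simp add: res6_def Let_def B_def A'_def a_def)
    have "count ?R = word_count (dual_word (drop t' ?w2) @ [- c] @ drop t ?w1)"
      using count_glue[OF staircase_rev_snake[OF A'(1)] A(1) B(1,2) \<open>a \<in> {North, East}\<close>]
      by (simp add: R A c' B(4) A'(4))
    also have "\<dots> = word_count (dual_word (dual_word (drop t' ?w2) @ [- c] @ drop t ?w1))"
      using w c(1) by (intro word_count_dual_word[symmetric]) (auto simp: dual_word_def dest: in_set_dropD)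
    finally have "count ?R = word_count (dual_word (drop t ?w1) @ [c] @ drop t' ?w2)" by simp
    moreover have "drop (t - 1) ?w1 = c # drop t ?w1" "drop (t' - 1) ?w2 = - c # drop t' ?w2"
      using drop_signs_Cons[OF t(1) both(1), of f1] drop_signs_Cons[OF t(3) both(2), of f2] c both
      by simp_all
    moreover have "sign_word (dual_word (drop t ?w1))" "sign_word (dual_word (drop t' ?w2))"
      using w by (auto intro!: sign_word_dual_word dest: in_set_dropD)
    moreover have "- c \<in> {1, -1}" using c(1) by auto
    ultimately show ?thesis
      using wedge_word_vec_snoc[of "dual_word (drop t ?w1)" "dual_word (drop t' ?w2)" "- c"]
      by (simp add: R proper_graph_of)
  next
    case second
    have R: "?R = final_piece rev_snake G2 f2 (t' + 1) (- c)"
      using second c by (simp add: res6_def)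
    have i: "1 \<le> t' + 1" "t' + 1 \<le> length G2" using second by auto
    have "- c \<in> {1, -1}" using c by auto
    then show ?thesis
      using count_final_piece[OF G2 i, of "- c" rev_snake] proper_final_piece[OF G2 i, of "- c" rev_snake]
        drop_signs_Cons[OF t(3) second(2), of f2] wedge_word_vec_Nil[OF c(1)] c second
        wedge_swap[of "(1, 1)"] count_rev_snake
      unfolding R by simp
  next
    case first
    have R: "?R = final_piece (\<lambda>A. A) G1 f1 (t + 1) c"
      using first c by (simp add: res6_def)
    have i: "1 \<le> t + 1" "t + 1 \<le> length G1" using first by auto
    have "- c \<in> {1, -1}" using c by auto
    then show ?thesis
      using count_final_piece[OF G1 i c(1), of "\<lambda>A. A"] proper_final_piece[OF G1 i c(1), of "\<lambda>A. A"]
        drop_signs_Cons[OF t(1) first(1), of f1] wedge_word_vec_Nil[of "- c"] c first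
      unfolding R by simp
  qed
  then show "proper ?R"
    "wedge (word_vec (dual_word (drop (t - 1) ?w1))) (word_vec (dual_word (drop (t' - 1) ?w2))) = c
        * count ?R"
    by simp_all
qed

lemma proper_res3: "proper (res3 G1 G2 t t')"
  by (simp add: res3_def proper_graph_of)

text \<open>
  The signs \<open>c\<close> and \<open>c'\<close> of the two ends appear in \<open>wedge_res5\<close> and \<open>wedge_res6\<close> as
  \<open>- c\<close> and \<open>c'\<close>. Each of the four clauses of the crossing condition amounts to \<open>c' = - c\<close>, which
  makes the product of the two determinants positive.
\<close>

lemma resolution_count:
  assumes G1: "staircase G1" "sign_function f1 G1" and G2: "staircase G2" "sign_function f2 G2"
    and st: "1 \<le> s" "s \<le> t" "t \<le> length G1" "1 \<le> s'" "s' \<le> t'" "t' \<le> length G2"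
    and word: "signs f1 (sub_snake G1 s t) = signs f2 (sub_snake G2 s' t')"
    and agree: "f1 (side_edge North (nth_tile G1 s)) = f2 (side_edge North (nth_tile G2 s'))"
      "f1 (side_edge North (nth_tile G1 t)) = f2 (side_edge North (nth_tile G2 t'))"
    and opposite: "1 < s \<Longrightarrow> 1 < s' \<Longrightarrow> f1 (interior_edge G1 (s - 1)) = - f2 (interior_edge G2 (s' - 1))"
      "t < length G1 \<Longrightarrow> t' < length G2 \<Longrightarrow> f1 (interior_edge G1 t) = - f2 (interior_edge G2 t')"
    and cross: "crosses G1 G2 s t s' t' f1 f2"
  shows "proper (res5 G1 G2 s s' f1 f2)" (is ?P5)
    and "proper (res6 G1 G2 t t' f1 f2)" (is ?P6)
    and "count (graph_of G1) * count (graph_of G2) =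
      count (res3 G1 G2 t t') * count (res4 G1 G2 t t') +
      count (res5 G1 G2 s s' f1 f2) * count (res6 G1 G2 t t' f1 f2)" (is ?C)
proof -
  let ?w1 = "signs f1 G1" and ?w2 = "signs f2 G2"
  define c where "c = (if 1 < s then f1 (interior_edge G1 (s - 1)) else - f2 (interior_edge G2 (s' - 1)))"
  define c' where "c' = (if t < length G1 then f1 (interior_edge G1 t) else - f2 (interior_edge G2 t'))"
  have ends: "s \<noteq> 1 \<or> s' \<noteq> 1" "t \<noteq> length G1 \<or> t' \<noteq> length G2"
    using cross by (auto simp: crosses_def Let_def)
  have c: "c \<in> {1, -1}"
  proof (cases "1 < s")
    case True
    then show ?thesis using interior_edge_sign[OF G1, of "s - 1"] st by (auto simp: c_def)
  next
    case False
    then have "f2 (interior_edge G2 (s' - 1)) \<in> {1, -1}"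
      using interior_edge_sign[OF G2, of "s' - 1"] st ends by auto
    then show ?thesis using False by (auto simp: c_def)
  qed
  have c's: "1 < s' \<Longrightarrow> f2 (interior_edge G2 (s' - 1)) = - c" "1 < s \<Longrightarrow> f1 (interior_edge G1 (s - 1)) = c"
    "t' < length G2 \<Longrightarrow> f2 (interior_edge G2 t') = - c'" "t < length G1 \<Longrightarrow> f1 (interior_edge G1 t) = c'"
    using opposite by (auto simp: c_def c'_def)
  have cc': "c' = - c"
    using cross c's ends unfolding crosses_def Let_def by auto
  then have c': "c' \<in> {1, -1}" using c by auto
  show ?P5
    by (rule proper_res5[OF G1 G2 _ _ _ _ ends(1) agree(1) c c's(2,1)]) (use st in auto)
  show ?P6
    by (rule proper_res6[OF G1 G2 _ _ _ _ ends(2) agree(2) c' c's(4,3)]) (use st in auto)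
  have w5: "wedge (word_vec (take (s - 1) ?w1)) (word_vec (take (s' - 1) ?w2)) = - c
      * count (res5 G1 G2 s s' f1 f2)"
    by (rule wedge_res5[OF G1 G2 _ _ _ _ ends(1) agree(1) c c's(2,1)]) (use st in auto)
  have w6: "wedge (word_vec (dual_word (drop (t - 1) ?w1))) (word_vec (dual_word (drop (t' - 1) ?w2)))
      = c' * count (res6 G1 G2 t t' f1 f2)"
    by (rule wedge_res6[OF G1 G2 _ _ _ _ ends(2) agree(2) c' c's(4,3)]) (use st in auto)
  define x where "x = drop (s - 1) (take (t - 1) ?w1)"
  have x: "take (t - 1) ?w1 = take (s - 1) ?w1 @ x" "take (t' - 1) ?w2 = take (s' - 1) ?w2 @ x"
    using word st append_take_drop_id[of "s - 1" "take (t - 1) ?w1"]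
      append_take_drop_id[of "s' - 1" "take (t' - 1) ?w2"]
    by (simp_all add: signs_sub_snake x_def min_absorb1)
  have w: "?w1 = take (s - 1) ?w1 @ x @ drop (t - 1) ?w1" "?w2 = take (s' - 1) ?w2 @ x @ drop (t' - 1) ?w2"
    using x append_take_drop_id[of "t - 1" ?w1] append_take_drop_id[of "t' - 1" ?w2] by simp_all
  have "count (res3 G1 G2 t t') = word_count (take (s - 1) ?w1 @ x @ drop (t' - 1) ?w2)"
    using count_res3[OF G1 G2 _ _ _ _ agree(2)] st x by simp
  moreover have "count (res4 G1 G2 t t') = word_count (take (s' - 1) ?w2 @ x @ drop (t - 1) ?w1)"
    using count_res3[OF G2 G1 _ _ _ _ agree(2)[symmetric]] st x by (simp add: res4_eq_res3)
  moreover have "sign_word (take (s - 1) ?w1 @ x @ drop (t - 1) ?w1)"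
    "sign_word (take (s' - 1) ?w2 @ x @ drop (t' - 1) ?w2)"
    unfolding w[symmetric] using G1 G2 by (simp_all only: sign_word_signs)
  note exchange = word_count_exchange[OF this, folded w, unfolded w5 w6]
  have "c * c' = - 1" using c cc' by auto
  then have "- c * a * (c' * b) = a * b" for a b
    by (metis (no_types, opaque_lifting) minus_mult_left mult.commute mult.left_commute
        mult.right_neutral mult_minus1 minus_minus)
  ultimately show ?C
    using exchange count_graph_of[OF G1] count_graph_of[OF G2] by simp
qed

section \<open>Maximality of an overlap\<close>

lemma staircase_distinct:
  assumes "staircase G"
  shows "distinct G"
  unfolding distinct_conv_nth
proof (intro allI impI)
  fix i j assume "i < length G" "j < length G" "i \<noteq> j"
  then show "G ! i \<noteq> G ! j"
    using staircase_height[OF assms, of i j] staircase_height[OF assms, of j i]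
    by (cases "i \<le> j") auto
qed

lemma move_shift: "move m (T + shift a) = move m T + shift (if fst m then partner a else a)"
  by (cases T; cases "snd m"; cases a) (auto simp: move_def)

lemma partner_partner [simp]: "partner (partner a) = a"
  by (cases a) auto

lemma sub_snake_Cons: "1 < s \<Longrightarrow> s \<le> t \<Longrightarrow> t \<le> length H \<Longrightarrow>
  sub_snake H (s - 1) t = nth_tile H (s - 1) # sub_snake H s t"
  using Cons_nth_drop_Suc[of "s - 2" "take t H"]
  by (simp add: sub_snake_def nth_tile_def numeral_2_eq_2 Suc_diff_Suc)

lemma sub_snake_snoc: "1 \<le> s \<Longrightarrow> s \<le> t \<Longrightarrow> t < length H \<Longrightarrow>
  sub_snake H s (t + 1) = sub_snake H s t @ [nth_tile H (t + 1)]"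
  by (simp add: sub_snake_def nth_tile_def take_Suc_conv_app_nth)

lemma embedding_hd_last:
  assumes "embedding m G H s t"
  shows "G \<noteq> []" "nth_tile H s = move m (hd G)" "nth_tile H t = move m (last G)"
proof -
  have st: "1 \<le> s" "s \<le> t" "t \<le> length H" and G: "map (move m) G = sub_snake H s t"
    using assms by (simp_all add: embedding_def)
  show ne: "G \<noteq> []" using G st by (auto simp: sub_snake_def)
  show "nth_tile H s = move m (hd G)" "nth_tile H t = move m (last G)"
    using hd_sub_snake[OF st] last_sub_snake[OF st] ne unfolding G[symmetric]
    by (simp_all add: hd_map last_map)
qed

text \<open>
  An embedding whose image does not begin at the first tile of \<open>H\<close> extends by the tile that lies
  across the side of \<open>hd G\<close> mapped to the interior edge before the image.
\<close>

lemma embedding_Cons: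
  assumes H: "staircase H" and m: "embedding m G H s t" and s: "1 < s"
  obtains a where "a \<in> {South, West}" "embedding m ((hd G + shift a) # G) H (s - 1) t"
    "interior_edge H (s - 1) = move m ` side_edge a (hd G)"
proof -
  have st: "s \<le> t" "t \<le> length H" and G: "map (move m) G = sub_snake H s t"
    using m by (simp_all add: embedding_def)
  have i: "1 \<le> s - 1" "s - 1 < length H" "s - 1 + 1 = s" using s st by auto
  note hd = embedding_hd_last[OF m]
  consider "nth_tile H s = nth_tile H (s - 1) + (0, 1)" | "nth_tile H s = nth_tile H (s - 1) + (1, 0)"
    using adjacent_nth_tile[OF H i(1,2)] unfolding i(3) by blast
  then have "\<exists>b\<in>{South, West}. nth_tile H (s - 1) = nth_tile H s + shift b \<and>
    interior_edge H (s - 1) = side_edge b (nth_tile H s)"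
  proof cases
    case 1
    then have "nth_tile H (s - 1) = nth_tile H s + shift South"
      by (cases "nth_tile H (s - 1)") simp
    then show ?thesis unfolding interior_edge_eq i(3) using 1 by auto
  next
    case 2
    then have "nth_tile H (s - 1) = nth_tile H s + shift West"
      by (cases "nth_tile H (s - 1)") simp
    then show ?thesis unfolding interior_edge_eq i(3) using 2 by auto
  qed
  then obtain b where b: "b \<in> {South, West}" "nth_tile H (s - 1) = nth_tile H s + shift b"
    "interior_edge H (s - 1) = side_edge b (nth_tile H s)" by blast
  \<comment> \<open>the side of the first tile of \<open>G\<close> that \<open>m\<close> maps to side \<open>b\<close>\<close>
  define a where "a = (if fst m then partner b else b)"
  have ab: "(if fst m then partner a else a) = b" by (simp add: a_def)
  have "move m (hd G + shift a) = nth_tile H (s - 1)"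
    unfolding move_shift ab b(2) hd(2) ..
  then have "map (move m) ((hd G + shift a) # G) = sub_snake H (s - 1) t"
    using sub_snake_Cons[OF s st] G by simp
  then have "embedding m ((hd G + shift a) # G) H (s - 1) t"
    using i(1) st by (simp add: embedding_def le_diff_conv)
  moreover have "interior_edge H (s - 1) = move m ` side_edge a (hd G)"
    unfolding move_side_edge ab b(3) hd(2) ..
  moreover have "a \<in> {South, West}" using b(1) by (auto simp: a_def)
  ultimately show thesis using that by blast
qed

lemma embedding_snoc:
  assumes H: "staircase H" and m: "embedding m G H s t" and t: "t < length H"
  obtains a where "a \<in> {North, East}" "embedding m (G @ [last G + shift a]) H s (t + 1)"
    "interior_edge H t = move m ` side_edge a (last G)"
proof -
  have st: "1 \<le> s" "s \<le> t" "1 \<le> t" and G: "map (move m) G = sub_snake H s t"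
    using m by (simp_all add: embedding_def)
  note last = embedding_hd_last[OF m]
  obtain b where b: "b \<in> {North, East}" "nth_tile H (t + 1) = nth_tile H t + shift b"
    "interior_edge H t = side_edge b (nth_tile H t)"
    by (cases rule: step_cases[OF H st(3) t]) (metis insertI1 insertI2 shift.simps)+
  define a where "a = (if fst m then partner b else b)"
  have ab: "(if fst m then partner a else a) = b" by (simp add: a_def)
  have "move m (last G + shift a) = nth_tile H (t + 1)"
    unfolding move_shift ab b(2) last(3) ..
  then have "map (move m) (G @ [last G + shift a]) = sub_snake H s (t + 1)"
    using sub_snake_snoc[OF st(1,2) t] G by simp
  then have "embedding m (G @ [last G + shift a]) H s (t + 1)"
    using st t by (simp add: embedding_def)
  moreover have "interior_edge H t = move m ` side_edge a (last G)"
    unfolding move_side_edge ab b(3) last(3) ..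
  moreover have "a \<in> {North, East}" using b(1) by (auto simp: a_def)
  ultimately show thesis using that by blast
qed

text \<open>
  Maximality applied to an extension that is embedded by the same two motions.
\<close>

lemma maximal_overlap:
  assumes "overlap G i1 i2 s t s' t' G1 G2" "2 \<le> length G"
    and "staircase H" "embedding i1 H G1 a b" "embedding i2 H G2 a' b'" "set G \<subseteq> set H"
  shows "set H = set G"
proof -
  have "snake_graph H" by (rule staircase_imp_snake_graph) fact
  moreover have "move i1 ` set G \<subseteq> move i1 ` set H" "move i2 ` set G \<subseteq> move i2 ` set H"
    using assms(6) by auto
  ultimately have "move i1 ` set G = move i1 ` set H"
    using assms unfolding overlap_def by blast
  moreover have "inj (move i1)" by (auto simp: inj_def move_def)
  ultimately show ?thesis by (simp add: inj_image_eq_iff)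
qed

lemma induced_signs_side:
  assumes "induced_signs G i1 i2 G1 G2 f f1 f2" "T \<in> set G"
  shows "f1 (move i1 ` side_edge a T) = f (side_edge a T)" "f2 (move i2 ` side_edge a T)
      = f (side_edge a T)"
proof -
  have "side_edge a T \<in> edges (graph_of G)"
    using assms(2) side_edge_in_tile_edges[of a T] by (auto simp: edges_def graph_of_def)
  then show "f1 (move i1 ` side_edge a T) = f (side_edge a T)" "f2 (move i2 ` side_edge a T)
      = f (side_edge a T)"
    using assms(1) by (auto simp: induced_signs_def)
qed

text \<open>
  If the signs were equal, the interior edges before the overlap would be images of the same side
  of the first tile, as its south and west sides have opposite signs. Then one further tile
  could be added in front of the overlap, contrary to maximality. The argument at the end is the
  same. For a single tile the claim is part of the definition of an overlap.
\<close>

lemma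
  assumes G12: "staircase G1" "staircase G2"
    and ov: "overlap G i1 i2 s t s' t' G1 G2" and ind: "induced_signs G i1 i2 G1 G2 f f1 f2"
  shows overlap_start_signs: "1 < s \<Longrightarrow> 1 < s' \<Longrightarrow>
      f1 (interior_edge G1 (s - 1)) = - f2 (interior_edge G2 (s' - 1))"
    and overlap_end_signs: "t < length G1 \<Longrightarrow> t' < length G2 \<Longrightarrow>
      f1 (interior_edge G1 t) = - f2 (interior_edge G2 t')"
proof -
  have G: "staircase G" and emb: "embedding i1 G G1 s t" "embedding i2 G G2 s' t'"
    using ov snake_graph_imp_staircase by (auto simp: overlap_def)
  then have ne: "G \<noteq> []" by (simp add: staircase_def)
  have single: "length G = 1 \<or> 2 \<le> length G" using ne by (cases G; cases "tl G") auto
  have f: "sign_function f G" using ind by (simp add: induced_signs_def)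
  show "f1 (interior_edge G1 (s - 1)) = - f2 (interior_edge G2 (s' - 1))" if s: "1 < s" "1 < s'"
    using single
  proof
    assume "length G = 1"
    then show ?thesis using ov ind s unfolding overlap_def by blast
  next
    assume two: "2 \<le> length G"
    have hd: "hd G \<in> set G" using ne by simp
    then have signed: "tile_signed f (hd G)" using f by (simp add: sign_function_iff)
    obtain a where a: "a \<in> {South, West}" "embedding i1 ((hd G + shift a) # G) G1 (s - 1) t"
      "f1 (interior_edge G1 (s - 1)) = f (side_edge a (hd G))"
      using embedding_Cons[OF G12(1) emb(1) s(1)] induced_signs_side(1)[OF ind hd] by metis
    obtain b where b: "b \<in> {South, West}" "embedding i2 ((hd G + shift b) # G) G2 (s' - 1) t'"
      "f2 (interior_edge G2 (s' - 1)) = f (side_edge b (hd G))"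
      using embedding_Cons[OF G12(2) emb(2) s(2)] induced_signs_side(2)[OF ind hd] by metis
    have "a \<noteq> b"
    proof
      assume "a = b"
      have "adjacent (hd G + shift a) (hd G)" using a(1) by (auto simp: prod_eq_iff)
      then have H: "staircase ((hd G + shift a) # G)"
        using G ne by (cases G) (auto simp: staircase_def)
      have "set ((hd G + shift a) # G) = set G"
        by (rule maximal_overlap[OF ov two H a(2) b(2)[folded \<open>a = b\<close>]]) auto
      then show False using staircase_distinct[OF H] by auto
    qed
    then have "a = South \<and> b = West \<or> a = West \<and> b = South" using a(1) b(1) by blast
    then show ?thesis
      unfolding a(3) b(3) by (elim disjE conjE) (simp_all only: tile_signedD(2-)[OF signed] minus_minus)
  qed
  show "f1 (interior_edge G1 t) = - f2 (interior_edge G2 t')" if t: "t < length G1" "t' < length G2"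
    using single
  proof
    assume "length G = 1"
    then show ?thesis using ov ind t unfolding overlap_def by blast
  next
    assume two: "2 \<le> length G"
    have last: "last G \<in> set G" using ne by simp
    then have signed: "tile_signed f (last G)" using f by (simp add: sign_function_iff)
    obtain a where a: "a \<in> {North, East}" "embedding i1 (G @ [last G + shift a]) G1 s (t + 1)"
      "f1 (interior_edge G1 t) = f (side_edge a (last G))"
      using embedding_snoc[OF G12(1) emb(1) t(1)] induced_signs_side(1)[OF ind last] by metis
    obtain b where b: "b \<in> {North, East}" "embedding i2 (G @ [last G + shift b]) G2 s' (t' + 1)"
      "f2 (interior_edge G2 t') = f (side_edge b (last G))"
      using embedding_snoc[OF G12(2) emb(2) t(2)] induced_signs_side(2)[OF ind last] by metis
    have "a \<noteq> b"
    proof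
      assume "a = b"
      have "adjacent (last G) (last G + shift a)" using a(1) by auto
      then have H: "staircase (G @ [last G + shift a])"
        unfolding staircase_append using G ne by (simp add: staircase_def)
      have "set (G @ [last G + shift a]) = set G"
        by (rule maximal_overlap[OF ov two H a(2) b(2)[folded \<open>a = b\<close>]]) auto
      then show False using staircase_distinct[OF H] by auto
    qed
    then have "a = North \<and> b = East \<or> a = East \<and> b = North" using a(1) b(1) by blast
    then show ?thesis
      unfolding a(3) b(3) by (elim disjE conjE) (simp_all only: tile_signedD(2-)[OF signed] minus_minus)
  qed
qed

section \<open>The bijection for an overlap\<close>

text \<open>
  After replacing \<open>G2\<close> by its mirror image \<open>H2\<close> if necessary, the words of both graphs agree on the
  overlap, and so do the signs of its first and last tile. The mirror image has the same word as
  \<open>G2\<close>, hence the same number of matchings.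
\<close>

lemma overlap_resolution:
  assumes G12: "staircase G1" "staircase G2"
    and ov: "overlap G i1 i2 s t s' t' G1 G2" and ind: "induced_signs G i1 i2 G1 G2 f f1 f2"
  shows "\<exists>\<phi>. bij_betw \<phi> (Match (disjoint_union (graph_of G1) (graph_of G2)))
           (Match_list (Res G1 G2 i1 i2 s t s' t' f1 f2))"
proof -
  define m :: motion where "m = (fst i1 \<noteq> fst i2, (0, 0))"
  define \<sigma> where "\<sigma> = move m"
  define H2 where "H2 = map \<sigma> G2"
  define g2 where "g2 = (\<lambda>e. f2 (\<sigma> ` e))"
  have \<sigma>: "(if fst i1 = fst i2 then (\<lambda>p. p) else prod.swap) = \<sigma>"
    by (auto simp: \<sigma>_def m_def move_def fun_eq_iff zero_prod_def[symmetric])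
  have \<sigma>\<sigma>: "\<sigma> (\<sigma> p) = p" for p
    by (simp add: \<sigma>_def m_def move_def zero_prod_def[symmetric])
  then have \<sigma>\<sigma>_image: "\<sigma> ` \<sigma> ` e = e" for e by (auto simp: image_image)
  have f12: "sign_function f1 G1" "sign_function f2 G2" using ind by (simp_all add: induced_signs_def)
  have G: "staircase G" and emb: "embedding i1 G G1 s t" "embedding i2 G G2 s' t'"
    using ov snake_graph_imp_staircase by (auto simp: overlap_def)
  then have ne: "G \<noteq> []" by (simp add: staircase_def)
  have st: "1 \<le> s" "s \<le> t" "t \<le> length G1" "1 \<le> s'" "s' \<le> t'" "t' \<le> length G2"
    using emb by (simp_all add: embedding_def)
  have H2: "staircase H2" unfolding H2_def \<sigma>_def by (rule staircase_move[OF G12(2)])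
  have g2: "sign_function g2 H2"
    using f12(2) unfolding H2_def \<sigma>_def sign_function_move
    by (simp add: g2_def \<sigma>_def[symmetric] \<sigma>\<sigma>_image)
  have g2_signs: "signs g2 H2 = signs f2 G2"
    using G12(2) unfolding H2_def \<sigma>_def
    by (simp add: signs_move staircase_def) (simp add: g2_def \<sigma>_def[symmetric] \<sigma>\<sigma>_image)
  have len: "length H2 = length G2" by (simp add: H2_def)
  have g2_interior: "g2 (interior_edge H2 i) = f2 (interior_edge G2 i)" if "1 \<le> i" "i < length G2" for i
    using that nth_signs_interior[of i H2 g2] nth_signs_interior[of i G2 f2] g2_signs len by simp
  have "signs f1 (sub_snake G1 s t) = signs (\<lambda>e. f1 (move i1 ` e)) G"
    using emb(1) G by (simp add: embedding_def signs_move[symmetric] staircase_def)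
  also have "\<dots> = signs f G"
    by (rule signs_cong) (rule induced_signs_side(1)[OF ind])
  also have "\<dots> = signs (\<lambda>e. f2 (move i2 ` e)) G"
    by (rule signs_cong) (rule induced_signs_side(2)[OF ind, symmetric])
  also have "\<dots> = signs f2 (sub_snake G2 s' t')"
    using emb(2) G by (simp add: embedding_def signs_move[symmetric] staircase_def)
  also have "\<dots> = signs g2 (sub_snake H2 s' t')"
    by (simp add: signs_sub_snake g2_signs)
  finally have word: "signs f1 (sub_snake G1 s t) = signs g2 (sub_snake H2 s' t')" .
  have agree: "f1 (side_edge North (move i1 T)) = g2 (side_edge North (\<sigma> (move i2 T)))" if "T \<in> set G" for T
  proof -
    have "f1 (side_edge North (move i1 T)) = f (side_edge (if fst i1 then East else North) T)"
      using induced_signs_side(1)[OF ind that, of "if fst i1 then East else North"]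
      by (simp add: move_side_edge split: if_splits)
    moreover have "g2 (side_edge North (\<sigma> (move i2 T))) = f (side_edge (if fst i1 then East else North) T)"
    proof -
      have "side_edge North (\<sigma> (move i2 T)) = \<sigma> ` move i2 ` side_edge (if fst i1 then East else North) T"
        by (simp add: \<sigma>_def m_def move_side_edge)
      then show ?thesis
        using induced_signs_side(2)[OF ind that] by (simp add: g2_def \<sigma>\<sigma>_image)
    qed
    ultimately show ?thesis by simp
  qed
  have H2_tile: "nth_tile H2 i = \<sigma> (nth_tile G2 i)" if "1 \<le> i" "i \<le> length G2" for i
    using that by (simp add: H2_def nth_tile_def)
  have agree_ends: "f1 (side_edge North (nth_tile G1 s)) = g2 (side_edge North (nth_tile H2 s'))"
    "f1 (side_edge North (nth_tile G1 t)) = g2 (side_edge North (nth_tile H2 t'))"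
    using agree[of "hd G"] agree[of "last G"] ne st H2_tile[of s'] H2_tile[of t']
      embedding_hd_last[OF emb(1)] embedding_hd_last[OF emb(2)] by simp_all
  have opposite: "1 < s \<Longrightarrow> 1 < s' \<Longrightarrow> f1 (interior_edge G1 (s - 1)) = - g2 (interior_edge H2 (s' - 1))"
    "t < length G1 \<Longrightarrow> t' < length H2 \<Longrightarrow> f1 (interior_edge G1 t) = - g2 (interior_edge H2 t')"
    using overlap_start_signs[OF G12 ov ind] overlap_end_signs[OF G12 ov ind] st len
      g2_interior[of "s' - 1"] g2_interior[of t'] by simp_all
  have same_count: "count (graph_of G2) = count (graph_of H2)"
    using count_graph_of[OF G12(2) f12(2)] count_graph_of[OF H2 g2] g2_signs by simp
  show ?thesis
  proof (cases "crosses G1 H2 s t s' t' f1 g2")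
    case True
    then have "Res G1 G2 i1 i2 s t s' t' f1 f2 =
      [disjoint_union (res3 G1 H2 t t') (res4 G1 H2 t t'),
       disjoint_union (res5 G1 H2 s s' f1 g2) (res6 G1 H2 t t' f1 g2)]"
      by (simp add: Res_def Let_def \<sigma> H2_def g2_def)
    then show ?thesis
      using resolution_count[OF G12(1) f12(1) H2 g2 st[folded len] word agree_ends opposite True] same_count
      by (simp only:) (intro bij_Match_pair; simp add: proper_graph_of proper_res3 res4_eq_res3)
  next
    case False
    then have "Res G1 G2 i1 i2 s t s' t' f1 f2 = [disjoint_union (graph_of G1) (graph_of G2)]"
      by (simp add: Res_def Let_def \<sigma> H2_def g2_def)
    then show ?thesis
      by (simp only:) (intro bij_Match_list; simp add: finite_edges_disjoint_union finite_edges_graph_of)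
  qed
qed

section \<open>The bijection for a grafting\<close>

text \<open>
  Both \<open>G3\<close> and \<open>G6\<close> are glued along edges whose sign in \<open>G1\<close> is \<open>- c\<close>. The sign function \<open>h\<close> on
  \<open>G2\<close> is normalized so that \<open>\<delta>\<^sub>3'\<close> has this sign.
\<close>

lemma graft_interior:
  assumes G1: "staircase G1" "sign_function f1 G1" and G2: "staircase G2"
    and s: "1 < s" "s < length G1" and \<delta>: "\<delta> = (if next_is_north G1 s then East else North)"
  shows "\<exists>\<phi>. bij_betw \<phi> (Match (disjoint_union (graph_of G1) (graph_of G2)))
           (Match_list (Graft G1 G2 s \<delta> f1 f2))"
proof -
  let ?w = "signs f1 G1" and ?d = "length G1"
  define c where "c = f1 (interior_edge G1 s)"
  have s1: "1 \<le> s" using s by simp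
  have c: "c \<in> {1, -1}" unfolding c_def by (rule interior_edge_sign[OF G1 s1 s(2)])
  then have c': "- c \<in> {1, -1}" by auto
  have \<delta>': "\<delta> \<in> {North, East}" by (simp add: \<delta>)
  obtain h where h: "\<And>T. tile_signed h T" "h (side_edge (opposite_side \<delta>) (hd G2)) = - c"
    using lattice_sign_function[OF c', of "opposite_side \<delta>" "hd G2"] by blast
  have hG2: "sign_function h G2" by (simp add: sign_function_iff h)
  have signed: "tile_signed f1 (nth_tile G1 s)" "tile_signed f1 (nth_tile G1 (s + 1))"
    using G1 s by (simp_all add: sign_function_iff nth_tile_in_set)
  note sides = tile_signedD(2-)[OF signed(1)] tile_signedD(2-)[OF signed(2)] tile_signedD(2-)[OF h(1)[of
      "hd G2"]]
  define A B where "A = sub_snake G1 1 s" and "B = sub_snake G1 (s + 1) ?d"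
  have A: "staircase A" "sign_function f1 A" "last A = nth_tile G1 s" "signs f1 A = take (s - 1) ?w"
    unfolding A_def using s G1
    by (simp_all add: staircase_sub_snake sign_function_sub_snake last_sub_snake signs_sub_snake)
  have B: "staircase B" "sign_function f1 B" "hd B = nth_tile G1 (s + 1)" "signs f1 B = drop s ?w"
    unfolding B_def using s G1
    by (simp_all add: staircase_sub_snake sign_function_sub_snake hd_sub_snake signs_sub_snake)
  have signs_at: "f1 (side_edge \<delta> (nth_tile G1 s)) = - c"
    "f1 (side_edge (opposite_side \<delta>) (nth_tile G1 (s + 1))) = - c"
    "h (side_edge (rev_side \<delta>) (hd G2)) = c"
    using interior_edge_sign_eq[OF G1 s1 s(2)] next_tile_sign[OF G1 s1 s(2)] sides h(2)
    unfolding \<delta> c_def[symmetric] by (cases "next_is_north G1 s"; simp)+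
  define g3 g4 g5 g6 where "g3 = graph_of (glue A \<delta> G2 (opposite_side \<delta>))"
    and "g4 = final_piece (\<lambda>A. A) G1 f1 (s + 1) (- c)"
    and "g5 = initial_piece (\<lambda>A. A) G1 f1 s (- c)"
    and "g6 = graph_of (glue (rev_snake G2) \<delta> B (opposite_side \<delta>))"
  have Graft: "Graft G1 G2 s \<delta> f1 f2 = [disjoint_union g3 g4, disjoint_union g5 g6]"
    using s by (simp add: Graft_def Let_def g3_def g4_def g5_def g6_def A_def B_def c_def \<delta>)
  have 3: "count g3 = word_count (take (s - 1) ?w @ [- c] @ signs h G2)"
    using count_glue[OF A(1,2) G2 hG2 \<delta>'] signs_at h(2) by (simp add: g3_def A)
  have 4: "count g4 = component (- c) (word_vec (dual_word (drop s ?w)))" "proper g4"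
    using count_final_piece[OF G1 _ _ c', of "s + 1" "\<lambda>A. A"]
      proper_final_piece[OF G1 _ _ c', of "s + 1" "\<lambda>A. A"] s
    by (simp_all add: g4_def)
  have 5: "count g5 = component c (word_vec (take (s - 1) ?w))" "proper g5"
    using count_initial_piece[OF G1 _ _ c', of s "\<lambda>A. A"]
      proper_initial_piece[OF G1 _ _ c', of s "\<lambda>A. A"] s
    by (simp_all add: g5_def)
  note rev = reverse_negated_sign[OF G2 hG2]
  have 6: "count g6 = word_count (dual_word (signs h G2) @ [- c] @ drop s ?w)"
    using count_glue[OF staircase_rev_snake[OF G2] rev(1) B(1,2) \<delta>'] signs_at
    by (simp add: g6_def rev B)
  have w: "sign_word ?w" "sign_word (signs h G2)" using G1 hG2 by (simp_all only: sign_word_signs)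
  have "?w = take (s - 1) ?w @ [c] @ drop s ?w"
    using append_take_drop_id[of "s - 1" ?w] unfolding drop_signs_Cons[OF s1 s(2), of f1] c_def by simp
  then have "count (graph_of G1) = word_count (take (s - 1) ?w @ [c] @ drop s ?w)"
    using count_graph_of[OF G1] by simp
  moreover have "count (graph_of G2) = word_count (signs h G2)" by (rule count_graph_of[OF G2 hG2])
  moreover have "sign_word (take (s - 1) ?w)" "sign_word (drop s ?w)"
    using w by (auto dest: in_set_takeD in_set_dropD)
  ultimately have "count (graph_of G1) * count (graph_of G2) = count g3 * count g4 + count g5 * count g6"
    using word_count_graft_interior[OF _ _ w(2) c] by (simp only: 3 4 5 6)
  then show ?thesis
    unfolding Graft by (intro bij_Match_pair) (simp_all add: 4 5 g3_def g6_def proper_graph_of)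
qed

lemma graft_end:
  assumes G1: "staircase G1" "sign_function f1 G1" and G2: "staircase G2" "sign_function f2 G2"
    and \<delta>: "\<delta> \<in> {North, East}" "f2 (delta3' G2 \<delta>) = f1 (delta3 G1 (length G1) \<delta>)"
  shows "\<exists>\<phi>. bij_betw \<phi> (Match (disjoint_union (graph_of G1) (graph_of G2)))
           (Match_list (Graft G1 G2 (length G1) \<delta> f1 f2))"
proof -
  let ?w1 = "signs f1 G1" and ?w2 = "signs f2 G2" and ?d = "length G1"
  have ne: "G1 \<noteq> []" "G2 \<noteq> []" using G1 G2 by (auto simp: staircase_def)
  have d: "1 \<le> ?d" "1 \<le> length G2" using ne by (simp_all add: Suc_leI)
  define c where "c = f1 (delta3 G1 ?d \<delta>)"
  have ends: "nth_tile G1 ?d = last G1" "nth_tile G2 1 = hd G2"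
    using ne by (simp_all add: nth_tile_def last_conv_nth hd_conv_nth)
  have "tile_signed f1 (last G1)" using G1 ne by (simp add: sign_function_iff)
  then have c: "c \<in> {1, -1}" unfolding c_def delta3_def ends by (rule tile_signedD(1))
  define g3 g4 g5 g6 where "g3 = graph_of (glue G1 \<delta> G2 (opposite_side \<delta>))"
    and "g4 = single_edge (delta3 G1 ?d \<delta>)"
    and "g5 = initial_piece (\<lambda>A. A) G1 f1 ?d c"
    and "g6 = final_piece rev_snake G2 f2 1 c"
  have Graft: "Graft G1 G2 ?d \<delta> f1 f2 = [disjoint_union g3 g4, disjoint_union g5 g6]"
    by (simp add: Graft_def Let_def g3_def g4_def g5_def g6_def c_def sub_snake_def)
  have at: "f1 (side_edge \<delta> (last G1)) = c" "f2 (side_edge (opposite_side \<delta>) (hd G2)) = c"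
    using \<delta>(2) by (simp_all add: c_def delta3_def delta3'_def ends del: One_nat_def)
  have 3: "count g3 = word_count (?w1 @ [c] @ ?w2)"
    using count_glue[OF G1 G2 \<delta>(1)] at by (simp add: g3_def)
  have 4: "count g4 = 1" "proper g4"
    by (simp_all add: g4_def count_single_edge proper_single_edge delta3_def)
  have 5: "count g5 = component (- c) (word_vec ?w1)" "proper g5"
    using count_initial_piece[OF G1 d(1) le_refl c, of "\<lambda>A. A"]
      proper_initial_piece[OF G1 d(1) le_refl c, of "\<lambda>A. A"]
    by (simp_all add: g5_def)
  have 6: "count g6 = component c (word_vec (dual_word ?w2))" "proper g6"
    using count_final_piece[OF G2 le_refl d(2) c, of rev_snake]
      proper_final_piece[OF G2 le_refl d(2) c, of rev_snake]
      count_rev_snake by (simp_all add: g6_def)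
  have "count (graph_of G1) * count (graph_of G2) = count g3 * count g4 + count g5 * count g6"
    using word_count_graft_end[OF sign_word_signs[OF G1(2)] sign_word_signs[OF G2(2)] c]
    by (simp add: 3 4 5 6 count_graph_of[OF G1] count_graph_of[OF G2])
  then show ?thesis
    unfolding Graft by (intro bij_Match_pair) (simp_all add: 4 5 6 g3_def proper_graph_of)
qed

theorem theorem3p1:
  fixes G1 G2 :: "tile list"
  assumes "snake_graph G1" and "snake_graph G2"
  shows "(\<forall>G i1 i2 s t s' t' f f1 f2.
            overlap G i1 i2 s t s' t' G1 G2 \<and> induced_signs G i1 i2 G1 G2 f f1 f2 \<longrightarrow>
            (\<exists>\<phi>. bij_betw \<phi> (Match (disjoint_union (graph_of G1) (graph_of G2)))
                   (Match_list (Res G1 G2 i1 i2 s t s' t' f1 f2))))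
       \<and> (\<forall>s \<delta> f1 f2.
            graft_defined G1 s \<delta> \<and> sign_function f1 G1 \<and> sign_function f2 G2 \<and>
            (s = length G1 \<longrightarrow> f2 (delta3' G2 \<delta>) = f1 (delta3 G1 s \<delta>)) \<longrightarrow>
            (\<exists>\<phi>. bij_betw \<phi> (Match (disjoint_union (graph_of G1) (graph_of G2)))
                   (Match_list (Graft G1 G2 s \<delta> f1 f2))))"
proof -
  have G12: "staircase G1" "staircase G2"
    using assms by (simp_all only: snake_graph_imp_staircase)
  show ?thesis
  proof (intro conjI allI impI; elim conjE)
    fix G i1 i2 s t s' t' f f1 f2
    assume "overlap G i1 i2 s t s' t' G1 G2" "induced_signs G i1 i2 G1 G2 f f1 f2"
    then show "\<exists>\<phi>. bij_betw \<phi> (Match (disjoint_union (graph_of G1) (graph_of G2)))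
        (Match_list (Res G1 G2 i1 i2 s t s' t' f1 f2))"
      by (rule overlap_resolution[OF G12])
  next
    fix s \<delta> f1 f2
    assume "graft_defined G1 s \<delta>" and f: "sign_function f1 G1" "sign_function f2 G2"
      and agree: "s = length G1 \<longrightarrow> f2 (delta3' G2 \<delta>) = f1 (delta3 G1 s \<delta>)"
    then consider "1 < s" "s < length G1" "\<delta> = (if next_is_north G1 s then East else North)"
      | "s = length G1" "\<delta> \<in> {North, East}"
      unfolding graft_defined_def by blast
    then show "\<exists>\<phi>. bij_betw \<phi> (Match (disjoint_union (graph_of G1) (graph_of G2)))
        (Match_list (Graft G1 G2 s \<delta> f1 f2))"
    proof cases
      case 1
      then show ?thesis by (rule graft_interior[OF G12(1) f(1) G12(2)])
    next
      case 2
      then show ?thesis using graft_end[OF G12(1) f(1) G12(2) f(2)] agree by simp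
    qed
  qed
qed

end
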